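(* Let $\lambda=[\lambda_1,\ldots,\lambda_k]$ be a partition, $n$ a positive integer, and $v$ a strictly increasing vector of length $k$ with entries in $\{1,\ldots,n\}$. For a face $F$ of $P(v,\lambda,n)$, let $\psi(F)=\bigcup_M g(M)$, the union over the matrices $M\in M(v,\lambda,n)$ that are vertices of $F$. Then $\psi$ is a bijection between faces of $P(v,\lambda,n)$ and components of $\overline\Gamma_{(v,\lambda,n)}$; moreover $\psi$ is an isomorphism of posets (faces ordered by inclusion, components by containment), and $\dim F$ equals the number of regions $\mathcal{R}(\psi(F))$.
   Context: A partition is a weakly decreasing sequence of positive integers; $a_i$ is the number of parts equal to $i$. A sign matrix is a matrix with entries in $\{-1,0,1\}$ whose column partial sums from the top lie in $\{0,1\}$ and whose row partial sums from the left are nonnegative. $M(v,\lambda,n)$ is the set of $\lambda_1\times n$ sign matrices whose $i$-th row sums to $a_{\lambda_1-i+1}$ for each $i$ and whose $j$-th column sums to $1$ if $j$ is an entry of $v$ and $0$ otherwise; $P(v,\lambda,n)$ is its convex hull in $\mathbb{R}^{\lambda_1 n}$ (whose vertices are exactly $M(v,\lambda,n)$). The grid graph $\Gamma_{(\lambda_1,n)}$ has vertices $(i,j)$, $1\le i\le\lambda_1+1$, $1\le j\le n+1$, drawn as a rectangular grid, with a vertical edge $(i,j)$–$(i+1,j)$ and a horizontal edge $(i,j)$–$(i,j+1)$ for each $1\le i\le\lambda_1$, $1\le j\le n$; vertices with $i=\lambda_1+1$ or $j=n+1$ are boundary vertices. For $M\in M(v,\lambda,n)$ with column partial sums $c_{ij}$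 and row partial sums $r_{ij}$, the $0$-dimensional component $g(M)$ labels the vertical edge $(i,j)$–$(i+1,j)$ for $i<\lambda_1$ by $\{c_{ij}\}$, the last vertical edge $(\lambda_1,j)$–$(\lambda_1+1,j)$ by the fixed value $1$ if $j\in v$ and $0$ otherwise, the horizontal edge $(i,j)$–$(i,j+1)$ for $j<n$ by $0$ if $r_{ij}=0$ and $\star$ otherwise, and the last horizontal edge $(i,n)$–$(i,n+1)$ by the fixed value $a_{\lambda_1-i+1}$. The union of labelings takes unions of label sets on non-fixed vertical edges, $\star$ if either label is $\star$ (else $0$) on non-fixed horizontal edges, and keeps fixed labels. A component of $\overline\Gamma_{(v,\lambda,n)}$ is the empty labeling (empty component) or a union of a nonempty set of $0$-dimensional components; containment is edgewise inclusion with $0\subseteq\star$. Darkened edges are vertical edges labeled $\{0,1\}$ and horizontal edges labeled $\star$. $\mathcal{R}(\delta)$ is the number of bounded faces of the planar graph of darkened edges of $\delta$, with darkened edges ending at right/bottom boundary vertices regarded as meeting at one point in the exterior region; $\mathcal{R}$ of the empty component is $-1$, and the empty face has dimension $-1$. *)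

theory Defs
  imports "HOL-Analysis.Analysis"
begin

definition is_partition :: "nat list \<Rightarrow> bool" where
  "is_partition lam \<longleftrightarrow> sorted_wrt (\<ge>) lam \<and> (\<forall>x\<in>set lam. 0 < x)"

text \<open>The partial sum \<open>c\<^sub>i\<^sub>j\<close> down column \<open>j\<close> and the partial sum \<open>r\<^sub>i\<^sub>j\<close> along row \<open>i\<close>.
  Indices of matrices start at 1.\<close>

definition col_psum :: "(nat \<Rightarrow> nat \<Rightarrow> int) \<Rightarrow> nat \<Rightarrow> nat \<Rightarrow> int" where
  "col_psum M i j = (\<Sum>i'=1..i. M i' j)"

definition row_psum :: "(nat \<Rightarrow> nat \<Rightarrow> int) \<Rightarrow> nat \<Rightarrow> nat \<Rightarrow> int" where
  "row_psum M i j = (\<Sum>j'=1..j. M i j')"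

text \<open>An \<open>m \<times> n\<close> matrix is a function that vanishes outside \<open>{1..m} \<times> {1..n}\<close>, so that
  equality of functions is equality of matrices.\<close>

definition sign_matrix :: "nat \<Rightarrow> nat \<Rightarrow> (nat \<Rightarrow> nat \<Rightarrow> int) \<Rightarrow> bool" where
  "sign_matrix m n M \<longleftrightarrow>
     (\<forall>i j. i \<notin> {1..m} \<or> j \<notin> {1..n} \<longrightarrow> M i j = 0) \<and>
     (\<forall>i\<in>{1..m}. \<forall>j\<in>{1..n}.
        M i j \<in> {-1, 0, 1} \<and> col_psum M i j \<in> {0, 1} \<and> 0 \<le> row_psum M i j)"

text \<open>The set \<open>M(v,\<lambda>,n)\<close>; here \<open>hd lam\<close> is \<open>\<lambda>\<^sub>1\<close> and \<open>count_list lam i\<close> is \<open>a\<^sub>i\<close>.\<close>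

definition sign_matrices :: "nat list \<Rightarrow> nat list \<Rightarrow> nat \<Rightarrow> (nat \<Rightarrow> nat \<Rightarrow> int) set" where
  "sign_matrices v lam n =
     {M. sign_matrix (hd lam) n M \<and>
         (\<forall>i\<in>{1..hd lam}. (\<Sum>j=1..n. M i j) = int (count_list lam (hd lam - i + 1))) \<and>
         (\<forall>j\<in>{1..n}. (\<Sum>i=1..hd lam. M i j) = (if j \<in> set v then 1 else 0))}"

text \<open>The matrix space is \<open>real ^ 'c ^ 'r\<close> for linearly ordered index types \<open>'r\<close> (rows) and
  \<open>'c\<close> (columns), to be used with \<open>CARD('r) = \<lambda>\<^sub>1\<close> and \<open>CARD('c) = n\<close>. An index is identified
  with its position, a number between 1 and the size of the type.\<close>

definition position :: "'a::{finite,linorder} \<Rightarrow> nat" where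
  "position x = card {y. y \<le> x}"

definition real_matrix ::
    "(nat \<Rightarrow> nat \<Rightarrow> int) \<Rightarrow> real ^ 'c::{finite,linorder} ^ 'r::{finite,linorder}" where
  "real_matrix M = (\<chi> i j. real_of_int (M (position i) (position j)))"

definition sm_polytope ::
    "nat list \<Rightarrow> nat list \<Rightarrow> nat \<Rightarrow> (real ^ 'c::{finite,linorder} ^ 'r::{finite,linorder}) set" where
  "sm_polytope v lam n = convex hull (real_matrix ` sign_matrices v lam n)"

text \<open>\<open>Vert i j\<close> is the edge from \<open>(i,j)\<close> to \<open>(i+1,j)\<close> and \<open>Horiz i j\<close> the edge from \<open>(i,j)\<close>
  to \<open>(i,j+1)\<close>.\<close>

datatype edge = Vert nat nat | Horiz nat nat

definition grid_edges :: "nat \<Rightarrow> nat \<Rightarrow> edge set" where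
  "grid_edges m n = {Vert i j | i j. i \<in> {1..m} \<and> j \<in> {1..n}} \<union>
                    {Horiz i j | i j. i \<in> {1..m} \<and> j \<in> {1..n}}"

text \<open>\<open>Fixed\<close> is used on the last vertical and the last horizontal edges, \<open>Vals\<close> on the other
  vertical edges, \<open>Zero\<close> and \<open>Star\<close> on the other horizontal edges.\<close>

datatype label = Fixed nat | Vals "int set" | Zero | Star

text \<open>A labeling is undefined off the grid; the empty labeling is \<open>Map.empty\<close>.\<close>

type_synonym labeling = "edge \<Rightarrow> label option"

definition zero_dim_component ::
    "nat list \<Rightarrow> nat list \<Rightarrow> nat \<Rightarrow> (nat \<Rightarrow> nat \<Rightarrow> int) \<Rightarrow> labeling" where
  "zero_dim_component v lam n M e =
     (if e \<notin> grid_edges (hd lam) n then None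
      else Some (case e of
        Vert i j \<Rightarrow>
          if i < hd lam then Vals {col_psum M i j}
          else Fixed (if j \<in> set v then 1 else 0)
      | Horiz i j \<Rightarrow>
          if j < n then (if row_psum M i j = 0 then Zero else Star)
          else Fixed (count_list lam (hd lam - i + 1))))"

text \<open>Union of the labels that one edge receives from several labelings. All of them are then of
  the same kind, and they are all equal if they are fixed.\<close>

definition label_union :: "label set \<Rightarrow> label" where
  "label_union L =
     (if \<exists>c. Fixed c \<in> L then Fixed (THE c. Fixed c \<in> L)
      else if Star \<in> L then Star
      else if Zero \<in> L then Zero
      else Vals (\<Union>{A. Vals A \<in> L}))"

definition labeling_union :: "labeling set \<Rightarrow> labeling" where
  "labeling_union D e =
     (let L = {l. \<exists>\<delta>\<in>D. \<delta> e = Some l} in if L = {} then None else Some (label_union L))"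

definition grid_components :: "nat list \<Rightarrow> nat list \<Rightarrow> nat \<Rightarrow> labeling set" where
  "grid_components v lam n =
     insert Map.empty
       {labeling_union D | D. D \<noteq> {} \<and> D \<subseteq> zero_dim_component v lam n ` sign_matrices v lam n}"

fun label_le :: "label \<Rightarrow> label \<Rightarrow> bool" where
  "label_le (Fixed a) (Fixed b) \<longleftrightarrow> a = b"
| "label_le (Vals A) (Vals B) \<longleftrightarrow> A \<subseteq> B"
| "label_le Zero Zero \<longleftrightarrow> True"
| "label_le Zero Star \<longleftrightarrow> True"
| "label_le Star Star \<longleftrightarrow> True"
| "label_le _ _ \<longleftrightarrow> False"

definition labeling_le :: "labeling \<Rightarrow> labeling \<Rightarrow> bool" where
  "labeling_le \<delta> \<epsilon> \<longleftrightarrow> (\<forall>e l. \<delta> e = Some l \<longrightarrow> (\<exists>l'. \<epsilon> e = Some l' \<and> label_le l l'))"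

definition dark_edges :: "labeling \<Rightarrow> edge set" where
  "dark_edges \<delta> = {Vert i j | i j. \<delta> (Vert i j) = Some (Vals {0, 1})} \<union>
                  {Horiz i j | i j. \<delta> (Horiz i j) = Some Star}"

text \<open>The grid is drawn in the plane as a matrix is written: \<open>i\<close> grows downwards and \<open>j\<close> to the
  right.\<close>

definition vertex_point :: "nat \<Rightarrow> nat \<Rightarrow> real \<times> real" where
  "vertex_point i j = (real j, - real i)"

fun edge_segment :: "edge \<Rightarrow> (real \<times> real) set" where
  "edge_segment (Vert i j) = closed_segment (vertex_point i j) (vertex_point (i + 1) j)"
| "edge_segment (Horiz i j) = closed_segment (vertex_point i j) (vertex_point i (j + 1))"

text \<open>The arc through all bottom and right boundary vertices. It stands for the point of the
  exterior at which darkened edges that end at these vertices are regarded as meeting: contracting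
  the arc to a point does not change the number of bounded faces, and the arc alone bounds none.\<close>

definition boundary_arc :: "nat \<Rightarrow> nat \<Rightarrow> (real \<times> real) set" where
  "boundary_arc m n =
     closed_segment (vertex_point (m + 1) 1) (vertex_point (m + 1) (n + 1)) \<union>
     closed_segment (vertex_point (m + 1) (n + 1)) (vertex_point 1 (n + 1))"

text \<open>The number of regions of a labeling of the grid with parameters \<open>m = \<lambda>\<^sub>1\<close> and \<open>n\<close>: bounded
  faces are the bounded connected components of the complement of the drawing.\<close>

definition regions :: "nat \<Rightarrow> nat \<Rightarrow> labeling \<Rightarrow> int" where
  "regions m n \<delta> =
     (if \<delta> = Map.empty then -1
      else int (card {C \<in> components (- ((\<Union>e\<in>dark_edges \<delta>. edge_segment e) \<union> boundary_arc m n)).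
                      bounded C}))"

definition psi ::
    "nat list \<Rightarrow> nat list \<Rightarrow> nat \<Rightarrow>
     (real ^ 'c::{finite,linorder} ^ 'r::{finite,linorder}) set \<Rightarrow> labeling" where
  "psi v lam n F =
     labeling_union (zero_dim_component v lam n `
       {M \<in> sign_matrices v lam n. real_matrix M extreme_point_of F})"

end

theory Submission
  imports Defs
begin

text \<open>
The column and row partial sums of a matrix are a flow on the grid, and \<open>P\<close> is the set of all real
matrices with column partial sums in \<open>[0, 1]\<close>, nonnegative row partial sums and the prescribed boundary
values. This flow is the coboundary of the corner sums \<open>h i j = (\<Sum>i'\<le>i. \<Sum>j'\<le>j. X i' j')\<close>, regarded as a
function on the cells of the grid that has integer values outside the grid. A nonintegral point can be
moved along the indicator of a level set of \<open>h\<close> modulo 1, so the extreme points are the sign matrices.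

A nonempty face is cut out by its tight inequalities, and \<open>psi\<close> records exactly these: an edge is dark
if and only if no inequality on it is tight. The direction space of the face consists of the functions
\<open>h\<close> on cells that agree across every edge that is not dark and vanish outside. Its dimension is the
number of classes of cells, other than the outer one, under passing through edges that are not dark, and
these classes are the bounded faces of the drawing.
\<close>

section \<open>Systems of linear inequalities\<close>

text \<open>Two points need care. First, a labeling records only which constraints are tight. The
  column sums of sign matrices are 0 or 1, so the label sets {0}, {1}, {0, 1} tell which of the two
  bounds holds with equality throughout. Row sums have only a lower bound, and \<open>Zero\<close>
  against \<open>Star\<close> tells whether it does. Different sets of matrices may have the same
  union, but then they have the same tight constraints and hence the same smallest face. This is why
  every component comes from a face, and from only one. Second, regions are topological objects.
  They are counted by following the cell that contains a point: its class is locally constant off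
  the drawing, and every point can be joined to the center of its cell. The boundary arc enters as
  extra unit edges. Since last edges are never dark, the cells along the inside of the arc reach the
  outer cell around its open ends. So the cells of the outer class include all cells on which the
  fixed boundary values force the corner sums of a direction vector to vanish.\<close>

locale linear_system =
  fixes I :: "'k set" and f :: "'k \<Rightarrow> 'a::euclidean_space \<Rightarrow> real" and \<beta> :: "'k \<Rightarrow> real"
  assumes finite_I: "finite I"
    and linear_f: "\<And>k. linear (f k)"
begin

definition solutions :: "'a set" where
  "solutions = {x. \<forall>k\<in>I. \<beta> k \<le> f k x}"

definition tight :: "'a set \<Rightarrow> 'k set" where
  "tight S = {k\<in>I. \<forall>x\<in>S. f k x = \<beta> k}"

definition tight_solutions :: "'k set \<Rightarrow> 'a set" where
  "tight_solutions T = {x\<in>solutions. \<forall>k\<in>T. f k x = \<beta> k}"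

lemmas f_simps = linear_add[OF linear_f] linear_diff[OF linear_f] linear_scale[OF linear_f]

lemma tight_antimono: "S \<subseteq> S' \<Longrightarrow> tight S' \<subseteq> tight S"
  by (auto simp: tight_def)

lemma tight_subset: "tight S \<subseteq> I"
  by (auto simp: tight_def)

lemma continuous_f: "continuous_on A (f k)"
  by (simp add: linear_continuous_on linear_f linear_linear)

lemma closed_solutions: "closed solutions"
proof -
  have "solutions = (\<Inter>k\<in>I. {x. \<beta> k \<le> f k x})" by (auto simp: solutions_def)
  moreover have "closed {x. \<beta> k \<le> f k x}" for k
    by (intro closed_Collect_le continuous_f continuous_intros)
  ultimately show ?thesis by auto
qed

lemma convex_solutions: "convex solutions"
proof (rule convexI)
  fix x y and u v :: real
  assume *: "x \<in> solutions" "y \<in> solutions" "0 \<le> u" "0 \<le> v" "u + v = 1"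
  show "u *\<^sub>R x + v *\<^sub>R y \<in> solutions"
    unfolding solutions_def
  proof (intro CollectI ballI)
    fix k assume "k \<in> I"
    then have "u * \<beta> k \<le> u * f k x" "v * \<beta> k \<le> v * f k y"
      using * by (auto simp: solutions_def intro: mult_left_mono)
    then have "(u + v) * \<beta> k \<le> u * f k x + v * f k y" by (simp add: distrib_right)
    then show "\<beta> k \<le> f k (u *\<^sub>R x + v *\<^sub>R y)" using * by (simp add: f_simps)
  qed
qed

lemma convex_equation: "convex {x. f k x = \<beta> k}"
proof (rule convexI)
  fix x y and u v :: real
  assume *: "x \<in> {x. f k x = \<beta> k}" "y \<in> {x. f k x = \<beta> k}" "0 \<le> u" "0 \<le> v" "u + v = 1"
  then have "f k (u *\<^sub>R x + v *\<^sub>R y) = (u + v) * \<beta> k"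
    by (simp add: f_simps flip: distrib_right)
  then show "u *\<^sub>R x + v *\<^sub>R y \<in> {x. f k x = \<beta> k}" using * by simp
qed

text \<open>Each equation cuts out a convex set, so it passes from a set to its hull. This allows a
  face to be replaced by its vertices.\<close>

lemma tight_hull: "tight (convex hull S) = tight S"
proof (rule antisym[OF tight_antimono[OF hull_subset]])
  have "convex hull S \<subseteq> {x. f k x = \<beta> k}" if "k \<in> tight S" for k
    using that by (intro hull_minimal convex_equation) (auto simp: tight_def)
  then show "tight S \<subseteq> tight (convex hull S)" by (auto simp: tight_def)
qed

text \<open>A constraint with slack at \<open>x\<close> tolerates a small move in any direction, a
  tight one is unaffected by \<open>w\<close>, and finitely many tolerances have a positive
  minimum.\<close>

lemma perturb:
  assumes x: "x \<in> solutions" and w: "\<And>k. k \<in> I \<Longrightarrow> f k x = \<beta> k \<Longrightarrow> f k w = 0"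
  obtains \<epsilon> where "0 < \<epsilon>" "\<And>t. \<bar>t\<bar> \<le> \<epsilon> \<Longrightarrow> x + t *\<^sub>R w \<in> solutions"
proof -
  have "\<exists>\<epsilon>>0. \<forall>t. \<bar>t\<bar> \<le> \<epsilon> \<longrightarrow> \<beta> k \<le> f k x + t * f k w" if k: "k \<in> I" for k
  proof (cases "f k x = \<beta> k")
    case True
    then show ?thesis using w k by (intro exI[of _ 1]) auto
  next
    case False
    then have pos: "f k x - \<beta> k > 0" using x k by (force simp: solutions_def)
    \<comment> \<open>Slack divided by speed; the summand 1 keeps the denominator positive when
      \<open>f k w = 0\<close>.\<close>
    let ?e = "(f k x - \<beta> k) / (1 + \<bar>f k w\<bar>)"
    have "\<beta> k \<le> f k x + t * f k w" if t: "\<bar>t\<bar> \<le> ?e" for t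
    proof -
      have "\<bar>t * f k w\<bar> \<le> \<bar>t\<bar> * (1 + \<bar>f k w\<bar>)"
        by (simp add: abs_mult mult_left_mono)
      also have "\<dots> \<le> ?e * (1 + \<bar>f k w\<bar>)" using t by (intro mult_right_mono) auto
      also have "\<dots> = f k x - \<beta> k" by (simp add: add_nonneg_eq_0_iff)
      finally show ?thesis by linarith
    qed
    then show ?thesis using pos by (intro exI[of _ ?e]) (auto intro: divide_pos_pos add_pos_nonneg)
  qed
  then obtain e where e: "\<And>k. k \<in> I \<Longrightarrow> 0 < e k"
    "\<And>k t. k \<in> I \<Longrightarrow> \<bar>t\<bar> \<le> e k \<Longrightarrow> \<beta> k \<le> f k x + t * f k w"
    using bchoice[of I] by (metis (no_types, lifting))
  \<comment> \<open>The element 1 keeps \<open>Min\<close> meaningful when there are no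
    constraints.\<close>
  let ?\<epsilon> = "Min (insert 1 (e ` I))"
  have "0 < ?\<epsilon>" using finite_I e(1) by auto
  moreover have "x + t *\<^sub>R w \<in> solutions" if "\<bar>t\<bar> \<le> ?\<epsilon>" for t
    using that finite_I e(2) by (auto simp: solutions_def f_simps)
  ultimately show ?thesis using that by blast
qed

text \<open>Such a point plays the part of a relative interior point. It is built by averaging:
  slacks are nonnegative, so a constraint is tight at a midpoint only if it is tight at both ends,
  and each averaging step removes one accidental equality.\<close>

lemma strict_point:
  assumes "convex F" "F \<noteq> {}" "F \<subseteq> solutions"
  obtains x where "x \<in> F" "\<And>k. k \<in> I \<Longrightarrow> f k x = \<beta> k \<Longrightarrow> k \<in> tight F"
proof -
  have "\<exists>x\<in>F. \<forall>k\<in>J. f k x = \<beta> k \<longrightarrow> k \<in> tight F" if "finite J" "J \<subseteq> I" for J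
    using that
  proof (induction J)
    case empty
    then show ?case using assms by auto
  next
    case (insert l J)
    then obtain x where x: "x \<in> F" "\<forall>k\<in>J. f k x = \<beta> k \<longrightarrow> k \<in> tight F" by auto
    show ?case
    proof (cases "l \<in> tight F")
      case True
      then show ?thesis using x by auto
    next
      case False
      then obtain y where y: "y \<in> F" "f l y \<noteq> \<beta> l" using insert by (auto simp: tight_def)
      let ?z = "(1/2) *\<^sub>R x + (1/2) *\<^sub>R y"
      have ge: "\<beta> k \<le> f k x" "\<beta> k \<le> f k y" if "k \<in> I" for k
        using that x y assms by (auto simp: solutions_def)
      have zF: "?z \<in> F" using convexD[OF assms(1) x(1) y(1), of "1/2" "1/2"] by simp
      have "f k x = \<beta> k \<and> f k y = \<beta> k" if "k \<in> I" "f k ?z = \<beta> k" for k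
      proof -
        have "f k x / 2 + f k y / 2 = \<beta> k" using that(2) by (simp add: f_simps)
        then show ?thesis using ge[OF that(1)] by linarith
      qed
      then have "k \<in> tight F" if "k \<in> insert l J" "f k ?z = \<beta> k" for k
        using that x(2) y(2) insert.prems by blast
      then show ?thesis using zF by blast
    qed
  qed
  from this[OF finite_I subset_refl] that show ?thesis by auto
qed

text \<open>From a strict point \<open>x\<close> of \<open>F\<close> one can go a little beyond
  \<open>x\<close>, away from any \<open>y\<close> that satisfies the tight equations, without
  leaving the solution set. Then \<open>x\<close> lies inside a segment ending in \<open>y\<close>,
  and the face property puts \<open>y\<close> into \<open>F\<close>.\<close>

lemma face_eq_tight_solutions:
  assumes F: "F face_of solutions" "F \<noteq> {}"
  shows "F = tight_solutions (tight F)"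
proof
  show "F \<subseteq> tight_solutions (tight F)"
    using face_of_imp_subset[OF F(1)] by (auto simp: tight_solutions_def tight_def)
  show "tight_solutions (tight F) \<subseteq> F"
  proof
    fix y assume y: "y \<in> tight_solutions (tight F)"
    obtain x where x: "x \<in> F" "\<And>k. k \<in> I \<Longrightarrow> f k x = \<beta> k \<Longrightarrow> k \<in> tight F"
      using strict_point face_of_imp_convex[OF F(1)] F(2) face_of_imp_subset[OF F(1)] by metis
    have xs: "x \<in> solutions" using x F face_of_imp_subset by blast
    obtain \<epsilon> where \<epsilon>: "0 < \<epsilon>" "\<And>t. \<bar>t\<bar> \<le> \<epsilon> \<Longrightarrow> x + t *\<^sub>R (x - y) \<in> solutions"
      using perturb[OF xs, of "x - y"] x y by (auto simp: f_simps tight_solutions_def)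
    let ?z = "x + \<epsilon> *\<^sub>R (x - y)"
    show "y \<in> F"
    proof (cases "x = y")
      case False
      \<comment> \<open>The parameter at which the segment from \<open>?z\<close> to
        \<open>y\<close> passes through \<open>x\<close>.\<close>
      let ?u = "\<epsilon> / (1 + \<epsilon>)"
      have "?z = (1 + \<epsilon>) *\<^sub>R x - \<epsilon> *\<^sub>R y" by (simp add: algebra_simps)
      moreover have "1 - ?u = 1 / (1 + \<epsilon>)" using \<epsilon>(1) by (simp add: field_simps)
      ultimately have "(1 - ?u) *\<^sub>R ?z = (1 / (1 + \<epsilon>)) *\<^sub>R ((1 + \<epsilon>) *\<^sub>R x - \<epsilon> *\<^sub>R y)" by simp
      also have "\<dots> = x - ?u *\<^sub>R y"
        using \<epsilon>(1) by (simp only: scaleR_right_diff_distrib) simp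
      finally have "(1 - ?u) *\<^sub>R ?z = x - ?u *\<^sub>R y" .
      then have "x = (1 - ?u) *\<^sub>R ?z + ?u *\<^sub>R y" by simp
      moreover have "?z \<noteq> y"
      proof
        assume "?z = y"
        then have "(1 + \<epsilon>) *\<^sub>R (x - y) = 0" by (simp add: algebra_simps)
        then show False using \<epsilon>(1) False by simp
      qed
      moreover have "0 < ?u" "?u < 1" using \<epsilon>(1) by auto
      ultimately have "x \<in> open_segment ?z y" unfolding in_segment by blast
      moreover have "?z \<in> solutions" "y \<in> solutions"
        using \<epsilon> y by (auto simp: tight_solutions_def)
      ultimately show ?thesis using F(1) x(1) unfolding face_of_def by blast
    qed (use x in auto)
  qed
qed

text \<open>At an inner point of a segment the slack is a combination, with positive weights, of the
  nonnegative slacks at the ends, so it vanishes only if both of these do.\<close>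

lemma face_tight_solutions:
  assumes "T \<subseteq> I"
  shows "tight_solutions T face_of solutions"
  unfolding face_of_def
proof (intro conjI ballI impI)
  show "tight_solutions T \<subseteq> solutions" by (auto simp: tight_solutions_def)
  have "tight_solutions T = solutions \<inter> (\<Inter>k\<in>T. {x. f k x = \<beta> k})"
    by (auto simp: tight_solutions_def)
  moreover have "convex (\<Inter>k\<in>T. {x. f k x = \<beta> k})"
    by (intro convex_INT convex_equation)
  ultimately show "convex (tight_solutions T)" by (simp add: convex_Int convex_solutions)
next
  fix a b x
  assume a: "a \<in> solutions" and b: "b \<in> solutions" and x: "x \<in> tight_solutions T"
    and seg: "x \<in> open_segment a b"
  obtain u where u: "0 < u" "u < 1" "x = (1 - u) *\<^sub>R a + u *\<^sub>R b"
    using seg by (auto simp: in_segment)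
  have "f k a = \<beta> k \<and> f k b = \<beta> k" if k: "k \<in> T" for k
  proof -
    have ge: "0 \<le> f k a - \<beta> k" "0 \<le> f k b - \<beta> k" using a b k assms by (auto simp: solutions_def)
    have "(1 - u) * f k a + u * f k b = \<beta> k"
      using x k u(3) by (auto simp: tight_solutions_def f_simps)
    then have "(1 - u) * (f k a - \<beta> k) + u * (f k b - \<beta> k) = 0" by (simp add: algebra_simps)
    moreover have "0 \<le> (1 - u) * (f k a - \<beta> k)" "0 \<le> u * (f k b - \<beta> k)" using ge u by auto
    ultimately have "(1 - u) * (f k a - \<beta> k) = 0" "u * (f k b - \<beta> k) = 0" by linarith+
    then show ?thesis using u by auto
  qed
  then show "a \<in> tight_solutions T" "b \<in> tight_solutions T"
    using a b by (auto simp: tight_solutions_def)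
qed

lemma face_subset_iff:
  assumes "F face_of solutions" "F \<noteq> {}" "G face_of solutions" "G \<noteq> {}"
  shows "F \<subseteq> G \<longleftrightarrow> tight G \<subseteq> tight F"
proof
  assume "tight G \<subseteq> tight F"
  then have "tight_solutions (tight F) \<subseteq> tight_solutions (tight G)"
    by (auto simp: tight_solutions_def)
  then show "F \<subseteq> G" using face_eq_tight_solutions assms by simp
qed (rule tight_antimono)

text \<open>For a strict point \<open>x\<close>, the translate of the kernel by \<open>x\<close>
  contains \<open>F\<close> and is contained in the affine hull of \<open>F\<close>, so all three
  have the same dimension.\<close>

lemma aff_dim_face:
  assumes F: "F face_of solutions" "F \<noteq> {}"
  shows "aff_dim F = dim {w. \<forall>k\<in>tight F. f k w = 0}"
proof -
  let ?W = "{w. \<forall>k\<in>tight F. f k w = 0}"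
  have subspace: "subspace ?W" by (auto simp: subspace_def f_simps linear_0[OF linear_f])
  obtain x where x: "x \<in> F" "\<And>k. k \<in> I \<Longrightarrow> f k x = \<beta> k \<Longrightarrow> k \<in> tight F"
    using strict_point face_of_imp_convex[OF F(1)] F(2) face_of_imp_subset[OF F(1)] by metis
  have xs: "x \<in> solutions" using x F face_of_imp_subset by blast
  have "F \<subseteq> (+) x ` ?W"
  proof
    fix y assume "y \<in> F"
    then have "y - x \<in> ?W" using x by (auto simp: f_simps tight_def)
    then show "y \<in> (+) x ` ?W" by (auto intro!: rev_image_eqI[of "y - x"])
  qed
  then have "aff_dim F \<le> aff_dim ((+) x ` ?W)" by (rule aff_dim_subset)
  moreover have "(+) x ` ?W \<subseteq> affine hull F"
  proof (rule image_subsetI)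
    fix w assume w: "w \<in> ?W"
    obtain \<epsilon> where \<epsilon>: "0 < \<epsilon>" "\<And>t. \<bar>t\<bar> \<le> \<epsilon> \<Longrightarrow> x + t *\<^sub>R w \<in> solutions"
      using perturb[OF xs, of w] x w by auto
    have "x + \<epsilon> *\<^sub>R w \<in> tight_solutions (tight F)"
      using \<epsilon> w x by (auto simp: tight_solutions_def f_simps tight_def)
    then have "x + \<epsilon> *\<^sub>R w \<in> F" using face_eq_tight_solutions[OF F] by simp
    \<comment> \<open>Only a short step along \<open>w\<close> stays in \<open>F\<close>; the affine
      combination stretches it to full length.\<close>
    then have "(1 - 1 / \<epsilon>) *\<^sub>R x + (1 / \<epsilon>) *\<^sub>R (x + \<epsilon> *\<^sub>R w) \<in> affine hull F"
      using x(1) by (intro mem_affine) (auto simp: hull_inc)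
    moreover have "(1 - 1 / \<epsilon>) *\<^sub>R x + (1 / \<epsilon>) *\<^sub>R (x + \<epsilon> *\<^sub>R w) = x + w"
      using \<epsilon>(1) by (simp add: algebra_simps)
    ultimately show "x + w \<in> affine hull F" by simp
  qed
  then have "aff_dim ((+) x ` ?W) \<le> aff_dim F" 
    using aff_dim_subset[of "(+) x ` ?W" "affine hull F"] by simp
  moreover have "aff_dim ((+) x ` ?W) = dim ?W"
    by (simp add: aff_dim_translation_eq aff_dim_subspace[OF subspace])
  ultimately show ?thesis by simp
qed

end

section \<open>Partial sums of matrices\<close>

lemma bij_betw_position: "bij_betw (position :: 'a::{finite,linorder} \<Rightarrow> nat) UNIV {1..CARD('a)}"
proof -
  have less: "position x < position y" if "x < y" for x y :: 'a
    unfolding position_def using that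
    by (intro psubset_card_mono) (auto simp: psubset_eq set_eq_iff not_le intro!: exI[of _ y])
  have inj: "inj (position :: 'a \<Rightarrow> nat)"
  proof (rule injI)
    fix x y :: 'a
    assume "position x = position y"
    then show "x = y" using less[of x y] less[of y x] by (cases x y rule: linorder_cases) auto
  qed
  have "position x \<in> {1..CARD('a)}" for x :: 'a
  proof -
    have "0 < card {y. y \<le> x}" by (auto simp: card_gt_0_iff)
    then show ?thesis unfolding position_def by (auto intro: card_mono)
  qed
  then have "range (position :: 'a \<Rightarrow> nat) \<subseteq> {1..CARD('a)}" by auto
  moreover have "card (range (position :: 'a \<Rightarrow> nat)) = CARD('a)" using inj by (rule card_image)
  ultimately have "range (position :: 'a \<Rightarrow> nat) = {1..CARD('a)}"
    by (intro card_subset_eq) auto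
  then show ?thesis using inj by (simp add: bij_betw_def)
qed

text \<open>Extension by zero makes partial sums meaningful for all natural indices, so cells
  outside the grid need no separate treatment.\<close>

definition entry :: "real ^ 'c::{finite,linorder} ^ 'r::{finite,linorder} \<Rightarrow> nat \<Rightarrow> nat \<Rightarrow> real" where
  "entry X i j = (if i \<in> {1..CARD('r)} \<and> j \<in> {1..CARD('c)}
                  then X $ inv position i $ inv position j else 0)"

definition of_entries :: "(nat \<Rightarrow> nat \<Rightarrow> real) \<Rightarrow> real ^ 'c::{finite,linorder} ^ 'r::{finite,linorder}" where
  "of_entries g = (\<chi> r c. g (position r) (position c))"

lemma position_inv:
  "i \<in> {1..CARD('a)} \<Longrightarrow> position (inv position i :: 'a::{finite,linorder}) = i"
  using bij_betw_position[where 'a='a] by (simp add: bij_betw_def f_inv_into_f)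

lemma inv_position: "inv position (position x) = x"
  using bij_betw_position by (intro inv_f_f) (rule bij_betw_imp_inj_on)

lemma position_in: "position (x :: 'a::{finite,linorder}) \<in> {1..CARD('a)}"
  using bij_betw_position[where 'a='a] by (auto simp: bij_betw_def)

lemma entry_position: "entry X (position r) (position c) = X $ r $ c"
  unfolding entry_def using position_in[of r] position_in[of c] by (simp add: inv_position)

lemma entry_of_entries:
  "entry (of_entries g :: real ^ 'c::{finite,linorder} ^ 'r::{finite,linorder}) i j =
     (if i \<in> {1..CARD('r)} \<and> j \<in> {1..CARD('c)} then g i j else 0)"
  by (simp add: entry_def of_entries_def position_inv)

lemma entry_inject: "(\<And>i j. entry X i j = entry Y i j) \<Longrightarrow> X = Y"
  by (metis entry_position vec_eq_iff)

lemma linear_entry: "linear (\<lambda>X. entry X i j)"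
  by (rule linearI) (auto simp: entry_def)

lemma entry_outside: "i \<notin> {1..CARD('r)} \<or> j \<notin> {1..CARD('c)} \<Longrightarrow>
    entry (X :: real ^ 'c::{finite,linorder} ^ 'r::{finite,linorder}) i j = 0"
  by (auto simp: entry_def)

fun flow :: "real ^ 'c::{finite,linorder} ^ 'r::{finite,linorder} \<Rightarrow> edge \<Rightarrow> real" where
  "flow X (Vert i j) = (\<Sum>i'=1..i. entry X i' j)"
| "flow X (Horiz i j) = (\<Sum>j'=1..j. entry X i j')"

definition corner :: "real ^ 'c::{finite,linorder} ^ 'r::{finite,linorder} \<Rightarrow> nat \<Rightarrow> nat \<Rightarrow> real" where
  "corner X i j = (\<Sum>i'=1..i. \<Sum>j'=1..j. entry X i' j')"

lemma linear_flow: "linear (\<lambda>X. flow X e)"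
  by (cases e) (auto intro!: linear_compose_sum linear_entry)

lemma linear_corner: "linear (\<lambda>X. corner X i j)"
  unfolding corner_def by (intro linear_compose_sum ballI linear_entry)

lemma corner_0 [simp]: "corner X 0 j = 0" "corner X i 0 = 0"
  by (auto simp: corner_def)

text \<open>The edge \<open>Vert i (Suc j)\<close> is the common side of the cells
  \<open>(i, j)\<close> and \<open>(i, Suc j)\<close>: this fact and its horizontal counterpart are
  the coboundary formula.\<close>

lemma flow_Vert_Suc: "flow X (Vert i (Suc j)) = corner X i (Suc j) - corner X i j"
  by (simp add: corner_def sum.distrib)

lemma flow_Horiz_Suc: "flow X (Horiz (Suc i) j) = corner X (Suc i) j - corner X i j"
  by (simp add: corner_def)

lemma entry_Suc: "entry X (Suc i) j = flow X (Vert (Suc i) j) - flow X (Vert i j)"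
  by simp

lemma corner_inject:
  assumes "\<And>i j. corner X i j = corner Y i j"
  shows "X = Y"
proof (rule entry_inject)
  have "entry Z (Suc i) (Suc j) =
      corner Z (Suc i) (Suc j) - corner Z (Suc i) j - (corner Z i (Suc j) - corner Z i j)"
    for Z :: "real ^ 'a::{finite,linorder} ^ 'b::{finite,linorder}" and i j
    by (simp only: entry_Suc flow_Vert_Suc)
  then have "entry X (Suc i) (Suc j) = entry Y (Suc i) (Suc j)" for i j
    using assms by simp
  then show "entry X i j = entry Y i j" for i j
    by (cases i; cases j) (auto simp: entry_outside)
qed

lemma corner_eq_sum_flow: "corner X i j = (\<Sum>j'=1..j. flow X (Vert i j'))"
  "corner X i j = (\<Sum>i'=1..i. flow X (Horiz i' j))"
  unfolding corner_def by (simp_all only: flow.simps sum.swap[of _ "{1..j}" "{1..i}"])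

text \<open>Entries vanish off the grid, so a partial sum is zero before the first index and stays
  at its last value after the final one.\<close>

lemma flow_outside:
  assumes "e \<notin> grid_edges CARD('r) CARD('c)"
  shows "flow (X :: real ^ 'c::{finite,linorder} ^ 'r::{finite,linorder}) e =
    (case e of Vert i j \<Rightarrow> if i = 0 then 0 else flow X (Vert CARD('r) j)
             | Horiz i j \<Rightarrow> if j = 0 then 0 else flow X (Horiz i CARD('c)))"
proof (cases e)
  case (Vert i j)
  consider "i = 0" | "j \<notin> {1..CARD('c)}" | "i > CARD('r)"
    using assms Vert by (auto simp: grid_edges_def)
  then show ?thesis
  proof cases
    case 3
    then have "(\<Sum>i'=1..i. entry X i' j) = (\<Sum>i'=1..CARD('r). entry X i' j)"
      by (intro sum.mono_neutral_right) (auto intro: entry_outside)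
    then show ?thesis using Vert 3 by simp
  qed (use Vert in \<open>auto simp: entry_outside\<close>)
next
  case (Horiz i j)
  consider "j = 0" | "i \<notin> {1..CARD('r)}" | "j > CARD('c)"
    using assms Horiz by (auto simp: grid_edges_def)
  then show ?thesis
  proof cases
    case 3
    then have "(\<Sum>j'=1..j. entry X i j') = (\<Sum>j'=1..CARD('c). entry X i j')"
      by (intro sum.mono_neutral_right) (auto intro: entry_outside)
    then show ?thesis using Horiz 3 by simp
  qed (use Horiz in \<open>auto simp: entry_outside\<close>)
qed

text \<open>The mixed second difference, inverse to \<open>corner\<close>. Positions are at least 1,
  so the subtractions are not truncated.\<close>

definition of_corner :: "(nat \<Rightarrow> nat \<Rightarrow> real) \<Rightarrow> real ^ 'c::{finite,linorder} ^ 'r::{finite,linorder}" where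
  "of_corner h = of_entries (\<lambda>i j. h i j - h (i - 1) j - h i (j - 1) + h (i - 1) (j - 1))"

text \<open>Second differences telescope to \<open>h\<close> because \<open>h\<close> vanishes in
  row and column 0. Vanishing from the last row and column on makes the differences beyond the
  matrix zero, as the entries are there.\<close>

lemma corner_of_corner:
  assumes h: "\<And>i j. i = 0 \<or> j = 0 \<or> CARD('r) \<le> i \<or> CARD('c) \<le> j \<Longrightarrow> h i j = 0"
  shows "corner (of_corner h :: real ^ 'c::{finite,linorder} ^ 'r::{finite,linorder}) i j = h i j"
proof -
  have entry: "entry (of_corner h :: real ^ 'c::{finite,linorder} ^ 'r::{finite,linorder}) (Suc i) (Suc j) =
      h (Suc i) (Suc j) - h i (Suc j) - (h (Suc i) j - h i j)" for i j
    by (auto simp: of_corner_def entry_of_entries h)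
  have "(\<Sum>j'=1..j. entry (of_corner h :: real ^ 'c::{finite,linorder} ^ 'r::{finite,linorder}) (Suc i) j') =
      h (Suc i) j - h i j" for i
    by (induction j) (simp_all add: h entry)
  then show ?thesis
    unfolding corner_def by (induction i) (simp_all add: h)
qed

section \<open>The polytope as a set of flows\<close>

type_synonym ('c, 'r) matrix = "((real, 'c) vec, 'r) vec"

fun is_inner :: "nat \<Rightarrow> nat \<Rightarrow> edge \<Rightarrow> bool" where
  "is_inner m n (Vert i j) \<longleftrightarrow> i < m"
| "is_inner m n (Horiz i j) \<longleftrightarrow> j < n"

locale matrix_setting =
  fixes v lam :: "nat list" and n :: nat
    and P :: "(real ^ 'c::{finite,linorder} ^ 'r::{finite,linorder}) set"
  assumes rows: "CARD('r) = hd lam" and cols: "CARD('c) = n"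
    and P_def: "P = sm_polytope v lam n"
begin

abbreviation m :: nat where "m \<equiv> hd lam"

fun fixed_value :: "edge \<Rightarrow> nat" where
  "fixed_value (Vert i j) = (if j \<in> set v then 1 else 0)"
| "fixed_value (Horiz i j) = count_list lam (m - i + 1)"

text \<open>On a last edge the lower and the upper bound are the same fixed value, so the prescribed
  equations become pairs of inequalities that are tight at every solution.\<close>

definition lower :: "edge \<Rightarrow> real" where
  "lower e = (if is_inner m n e then 0 else fixed_value e)"

definition upper :: "edge \<Rightarrow> real" where
  "upper e = (if is_inner m n e then 1 else fixed_value e)"

text \<open>A constraint is an edge with a flag that tells the upper from the lower bound; inner
  horizontal edges have no upper bound.\<close>

definition constraints :: "(edge \<times> bool) set" where
  "constraints = {(e, s). e \<in> grid_edges m n \<and> (s \<longrightarrow> (\<forall>i j. e = Horiz i j \<longrightarrow> n \<le> j))}"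

definition functional :: "edge \<times> bool \<Rightarrow> ('c, 'r) matrix \<Rightarrow> real" where
  "functional k X = (if snd k then - flow X (fst k) else flow X (fst k))"

definition rhs :: "edge \<times> bool \<Rightarrow> real" where
  "rhs k = (if snd k then - upper (fst k) else lower (fst k))"

lemma finite_grid: "finite (grid_edges m n)"
proof -
  have "grid_edges m n = (\<lambda>(i, j). Vert i j) ` ({1..m} \<times> {1..n}) \<union> (\<lambda>(i, j). Horiz i j) ` ({1..m} \<times> {1..n})"
    by (force simp: grid_edges_def)
  then show ?thesis by simp
qed

sublocale linear_system constraints functional rhs
proof (rule linear_system.intro)
  have "constraints \<subseteq> grid_edges m n \<times> UNIV" by (auto simp: constraints_def)
  then show "finite constraints" using finite_grid by (metis finite_SigmaI finite finite_subset)
  show "linear (functional k)" for k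
    unfolding functional_def
    by (cases "snd k") (use linear_flow[of "fst k"] in \<open>auto intro: linear_compose_neg\<close>)
qed

lemma m_pos: "0 < m" and n_pos: "0 < n"
  using rows cols by (metis zero_less_card_finite)+

lemma grid_Vert: "Vert i j \<in> grid_edges m n \<longleftrightarrow> i \<in> {1..m} \<and> j \<in> {1..n}"
  and grid_Horiz: "Horiz i j \<in> grid_edges m n \<longleftrightarrow> i \<in> {1..m} \<and> j \<in> {1..n}"
  by (auto simp: grid_edges_def)

lemma solutions_Vert:
  assumes "X \<in> solutions" "i \<in> {1..m}" "j \<in> {1..n}"
  shows "0 \<le> flow X (Vert i j)" "flow X (Vert i j) \<le> 1"
    "i = m \<Longrightarrow> flow X (Vert i j) = fixed_value (Vert i j)"
proof -
  have "(Vert i j, False) \<in> constraints" "(Vert i j, True) \<in> constraints"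
    using assms by (auto simp: constraints_def grid_Vert)
  then have "lower (Vert i j) \<le> flow X (Vert i j)" "flow X (Vert i j) \<le> upper (Vert i j)"
    using assms(1) by (force simp: solutions_def rhs_def functional_def simp del: flow.simps)+
  then show "0 \<le> flow X (Vert i j)" "flow X (Vert i j) \<le> 1"
    "i = m \<Longrightarrow> flow X (Vert i j) = fixed_value (Vert i j)"
    by (auto simp: lower_def upper_def simp del: flow.simps split: if_splits)
qed

lemma solutions_Horiz:
  assumes "X \<in> solutions" "i \<in> {1..m}" "j \<in> {1..n}"
  shows "0 \<le> flow X (Horiz i j)" "j = n \<Longrightarrow> flow X (Horiz i j) = fixed_value (Horiz i j)"
proof -
  have "(Horiz i j, False) \<in> constraints" "j = n \<Longrightarrow> (Horiz i j, True) \<in> constraints"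
    using assms by (auto simp: constraints_def grid_Horiz)
  then have "lower (Horiz i j) \<le> flow X (Horiz i j)"
     "j = n \<Longrightarrow> flow X (Horiz i j) \<le> upper (Horiz i j)"
    using assms(1) by (force simp: solutions_def rhs_def functional_def simp del: flow.simps)+
  then show "0 \<le> flow X (Horiz i j)" "j = n \<Longrightarrow> flow X (Horiz i j) = fixed_value (Horiz i j)"
    by (auto simp: lower_def upper_def simp del: flow.simps split: if_splits)
qed

lemma solutionsI:
  assumes "\<And>i j. i \<in> {1..m} \<Longrightarrow> j \<in> {1..n} \<Longrightarrow> 0 \<le> flow X (Vert i j) \<and> flow X (Vert i j) \<le> 1"
    and "\<And>i j. i \<in> {1..m} \<Longrightarrow> j \<in> {1..n} \<Longrightarrow> 0 \<le> flow X (Horiz i j)"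
    and "\<And>j. j \<in> {1..n} \<Longrightarrow> flow X (Vert m j) = fixed_value (Vert m j)"
    and "\<And>i. i \<in> {1..m} \<Longrightarrow> flow X (Horiz i n) = fixed_value (Horiz i n)"
  shows "X \<in> solutions"
  unfolding solutions_def
proof (intro CollectI ballI)
  fix k assume k: "k \<in> constraints"
  obtain e s where es: "k = (e, s)" by (cases k)
  show "rhs k \<le> functional k X"
  proof (cases e)
    case (Vert i j)
    then have ij: "i \<in> {1..m}" "j \<in> {1..n}" using k es by (auto simp: constraints_def grid_Vert)
    then have "i < m \<or> i = m" by auto
    then show ?thesis using assms(1)[OF ij] assms(3)[OF ij(2)] es Vert
      by (auto simp: rhs_def functional_def lower_def upper_def simp del: flow.simps)
  next
    case (Horiz i j)
    then have ij: "i \<in> {1..m}" "j \<in> {1..n}" using k es by (auto simp: constraints_def grid_Horiz)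
    then have "j < n \<and> \<not> s \<or> j = n" using k es Horiz by (auto simp: constraints_def)
    then show ?thesis using assms(2)[OF ij] assms(4)[OF ij(1)] es Horiz
      by (auto simp: rhs_def functional_def lower_def upper_def simp del: flow.simps)
  qed
qed

text \<open>At or beyond the last row a corner sum adds up total column sums, at or beyond the last
  column total row sums, and these are the prescribed integers.\<close>

lemma corner_boundary_Ints:
  assumes X: "X \<in> solutions" and ij: "i = 0 \<or> j = 0 \<or> m \<le> i \<or> n \<le> j"
  shows "corner X i j \<in> \<int>"
proof -
  have V: "flow X (Vert i j) \<in> \<int>" if "m \<le> i" for i j
  proof (cases "Vert i j \<in> grid_edges m n")
    case True
    then show ?thesis using solutions_Vert(3)[OF X, of i j] that by (auto simp: grid_Vert simp del: flow.simps)
  next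
    case False
    have "flow X (Vert m j) \<in> \<int>"
    proof (cases "j \<in> {1..n}")
      case True
      then show ?thesis using solutions_Vert(3)[OF X, of m j] m_pos by (simp del: flow.simps)
    next
      case False
      then show ?thesis using cols by (auto simp: entry_outside)
    qed
    then show ?thesis using flow_outside[of "Vert i j" X] False rows cols by (auto simp del: flow.simps)
  qed
  have H: "flow X (Horiz i j) \<in> \<int>" if "n \<le> j" for i j
  proof (cases "Horiz i j \<in> grid_edges m n")
    case True
    then show ?thesis using solutions_Horiz(2)[OF X, of i j] that by (auto simp: grid_Horiz simp del: flow.simps)
  next
    case False
    have "flow X (Horiz i n) \<in> \<int>"
    proof (cases "i \<in> {1..m}")
      case True
      then show ?thesis using solutions_Horiz(2)[OF X, of i n] n_pos by (simp del: flow.simps)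
    next
      case False
      then show ?thesis using rows by (auto simp: entry_outside)
    qed
    then show ?thesis using flow_outside[of "Horiz i j" X] False rows cols by (auto simp del: flow.simps)
  qed
  consider "i = 0 \<or> j = 0" | "m \<le> i" | "n \<le> j" using ij by auto
  then show ?thesis
  proof cases
    case 2
    then show ?thesis unfolding corner_eq_sum_flow(1) by (intro Ints_sum V)
  next
    case 3
    then show ?thesis unfolding corner_eq_sum_flow(2) by (intro Ints_sum H)
  qed auto
qed

section \<open>Sign matrices as the integral points and the extreme points of the system\<close>

lemma entry_real_matrix:
  assumes "M \<in> sign_matrices v lam n"
  shows "entry (real_matrix M :: ('c, 'r) matrix) i j = M i j"
proof -
  have "(real_matrix M :: ('c, 'r) matrix) = of_entries (\<lambda>i j. real_of_int (M i j))"
    by (simp add: real_matrix_def of_entries_def)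
  then show ?thesis
    using assms rows cols by (auto simp: entry_of_entries sign_matrices_def sign_matrix_def)
qed

lemma flow_real_matrix:
  assumes "M \<in> sign_matrices v lam n"
  shows "flow (real_matrix M :: ('c, 'r) matrix) (Vert i j) = col_psum M i j"
    "flow (real_matrix M :: ('c, 'r) matrix) (Horiz i j) = row_psum M i j"
  by (simp_all add: entry_real_matrix[OF assms] col_psum_def row_psum_def)

lemma real_matrix_solution:
  assumes M: "M \<in> sign_matrices v lam n"
  shows "(real_matrix M :: ('c, 'r) matrix) \<in> solutions"
proof (rule solutionsI)
  show "0 \<le> flow (real_matrix M :: ('c, 'r) matrix) (Vert i j) \<and> flow (real_matrix M :: ('c, 'r) matrix) (Vert i j) \<le> 1"
    if "i \<in> {1..m}" "j \<in> {1..n}" for i j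
  proof -
    have "col_psum M i j \<in> {0, 1}" using M that by (auto simp: sign_matrices_def sign_matrix_def)
    then show ?thesis unfolding flow_real_matrix[OF M] by auto
  qed
  show "0 \<le> flow (real_matrix M :: ('c, 'r) matrix) (Horiz i j)" if "i \<in> {1..m}" "j \<in> {1..n}" for i j
    unfolding flow_real_matrix[OF M] using M that by (auto simp: sign_matrices_def sign_matrix_def)
  show "flow (real_matrix M :: ('c, 'r) matrix) (Vert m j) = fixed_value (Vert m j)" if "j \<in> {1..n}" for j
    unfolding flow_real_matrix[OF M] using M that by (auto simp: sign_matrices_def col_psum_def)
  show "flow (real_matrix M :: ('c, 'r) matrix) (Horiz i n) = fixed_value (Horiz i n)" if "i \<in> {1..m}" for i
    unfolding flow_real_matrix[OF M] using M that by (auto simp: sign_matrices_def row_psum_def)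
qed

lemma integral_solution:
  assumes X: "X \<in> solutions" and int: "\<And>i j. entry X i j \<in> \<int>"
  shows "X \<in> real_matrix ` sign_matrices v lam n"
proof -
  define M where "M i j = \<lfloor>entry X i j\<rfloor>" for i j
  have M: "real_of_int (M i j) = entry X i j" for i j
    using int[of i j] by (simp add: M_def)
  have X_eq: "X = real_matrix M"
  proof (rule entry_inject)
    have "(real_matrix M :: ('c, 'r) matrix) = of_entries (entry X)"
      by (simp add: real_matrix_def of_entries_def M)
    then show "entry X i j = entry (real_matrix M :: ('c, 'r) matrix) i j" for i j
      by (simp add: entry_of_entries entry_outside)
  qed
  have c: "real_of_int (col_psum M i j) = flow X (Vert i j)" for i j
    by (simp add: col_psum_def M)
  have r: "real_of_int (row_psum M i j) = flow X (Horiz i j)" for i j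
    by (simp add: row_psum_def M)
  \<comment> \<open>Row 0 is included because an entry is the difference of the column sums at
    \<open>i\<close> and \<open>i - 1\<close>, which bounds it by 1 in absolute value.\<close>
  have c01: "col_psum M i j \<in> {0, 1}" if "i \<le> m" "j \<in> {1..n}" for i j
  proof (cases "i = 0")
    case True
    then show ?thesis by (simp add: col_psum_def)
  next
    case False
    then have "0 \<le> real_of_int (col_psum M i j)" "real_of_int (col_psum M i j) \<le> 1"
      unfolding c using solutions_Vert[OF X, of i j] that by auto
    then show ?thesis by auto
  qed
  have "M \<in> sign_matrices v lam n"
    unfolding sign_matrices_def sign_matrix_def
  proof (intro CollectI conjI allI impI ballI)
    show "M i j = 0" if "i \<notin> {1..m} \<or> j \<notin> {1..n}" for i j
      using that rows cols by (simp add: M_def entry_outside)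
    fix i j assume ij: "i \<in> {1..m}" "j \<in> {1..n}"
    show "col_psum M i j \<in> {0, 1}" using c01 ij by simp
    obtain i' where i': "i = Suc i'" using ij by (cases i) auto
    have "M i j = col_psum M i j - col_psum M i' j" by (simp add: i' col_psum_def)
    then show "M i j \<in> {- 1, 0, 1}" using c01[of i j] c01[of i' j] ij i' by auto
    have "0 \<le> real_of_int (row_psum M i j)" unfolding r using solutions_Horiz(1)[OF X ij] .
    then show "0 \<le> row_psum M i j" by simp
  next
    fix i assume i: "i \<in> {1..m}"
    have "real_of_int (row_psum M i n) = fixed_value (Horiz i n)"
      unfolding r using solutions_Horiz(2)[OF X i, of n] n_pos by simp
    then have "row_psum M i n = int (fixed_value (Horiz i n))" by linarith
    then show "(\<Sum>j = 1..n. M i j) = int (count_list lam (m - i + 1))"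
      by (simp add: row_psum_def)
  next
    fix j assume j: "j \<in> {1..n}"
    have "real_of_int (col_psum M m j) = fixed_value (Vert m j)"
      unfolding c using solutions_Vert(3)[OF X _ j, of m] m_pos by simp
    then have "col_psum M m j = int (fixed_value (Vert m j))" by linarith
    then show "(\<Sum>i = 1..m. M i j) = (if j \<in> set v then 1 else 0)"
      by (simp add: col_psum_def split: if_splits)
  qed
  then show ?thesis using X_eq by blast
qed

text \<open>If some corner sum of \<open>x\<close> is not an integer, then \<open>x\<close> can be moved in both directions by
  the indicator function of the cells whose corner sums are congruent to it modulo 1: on the
  boundary of this set of cells the flow of \<open>x\<close> is not an integer, so no constraint is tight.\<close>

lemma extreme_imp_integral:
  assumes "x extreme_point_of solutions"
  shows "corner x i j \<in> \<int>"
proof (rule ccontr)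
  assume nonint: "corner x i j \<notin> \<int>"
  define h :: "nat \<Rightarrow> nat \<Rightarrow> real"
    where "h a b = (if corner x a b - corner x i j \<in> \<int> then 1 else 0)" for a b
  define w :: "('c, 'r) matrix" where "w = of_corner h"
  have x: "x \<in> solutions" using assms by (simp add: extreme_point_of_def)
  \<comment> \<open>Corner sums there are integers while \<open>corner x i j\<close> is not, so no
    such cell is congruent to \<open>(i, j)\<close>. Hence \<open>h\<close> is the corner function
    of an actual matrix.\<close>
  have "h a b = 0" if "a = 0 \<or> b = 0 \<or> m \<le> a \<or> n \<le> b" for a b
    using corner_boundary_Ints[OF x that] nonint Ints_diff by (fastforce simp: h_def)
  then have w: "corner w a b = h a b" for a b
    unfolding w_def using rows cols by (intro corner_of_corner) auto
  have same: "h a b = h a' b'" if "corner x a b - corner x a' b' \<in> \<int>" for a b a' b'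
  proof -
    have "corner x a b - corner x i j = (corner x a b - corner x a' b') + (corner x a' b' - corner x i j)"
      "corner x a' b' - corner x i j = (corner x a b - corner x i j) - (corner x a b - corner x a' b')"
      by simp_all
    then show ?thesis unfolding h_def using that by (metis Ints_add Ints_diff)
  qed
  have "functional k w = 0" if k: "k \<in> constraints" "functional k x = rhs k" for k
  proof -
    obtain e s where es: "k = (e, s)" by (cases k)
    have "flow x e \<in> {lower e, upper e}"
      using k es by (auto simp: functional_def rhs_def split: if_splits)
    then have fx: "flow x e \<in> \<int>" by (auto simp: lower_def upper_def)
    have "flow w e = 0"
    proof (cases e)
      case (Vert a b)
      moreover obtain b' where "b = Suc b'"
        using k es Vert by (cases b) (auto simp: constraints_def grid_Vert)
      ultimately show ?thesis using fx same by (simp add: flow_Vert_Suc w del: flow.simps)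
    next
      case (Horiz a b)
      moreover obtain a' where "a = Suc a'"
        using k es Horiz by (cases a) (auto simp: constraints_def grid_Horiz)
      ultimately show ?thesis using fx same by (simp add: flow_Horiz_Suc w del: flow.simps)
    qed
    then show ?thesis by (simp add: es functional_def)
  qed
  then obtain \<epsilon> where \<epsilon>: "0 < \<epsilon>" "\<And>t. \<bar>t\<bar> \<le> \<epsilon> \<Longrightarrow> x + t *\<^sub>R w \<in> solutions"
    using perturb[OF x] by metis
  let ?a = "x + \<epsilon> *\<^sub>R w" and ?b = "x + (- \<epsilon>) *\<^sub>R w"
  have "corner w i j = 1" using w by (simp add: h_def)
  moreover have "corner (0 :: ('c, 'r) matrix) i j = 0" by (rule linear_0[OF linear_corner])
  ultimately have "w \<noteq> 0" by auto
  then have "?a \<noteq> ?b" using \<epsilon>(1) by (simp add: eq_neg_iff_add_eq_0 flip: scaleR_add_left)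
  moreover have "midpoint ?a ?b = x" by (simp add: midpoint_def flip: scaleR_2)
  ultimately have "x \<in> open_segment ?a ?b" by (metis midpoint_in_open_segment)
  moreover have "?a \<in> solutions" "?b \<in> solutions" using \<epsilon>(1) \<epsilon>(2)[of \<epsilon>] \<epsilon>(2)[of "- \<epsilon>"] by auto
  ultimately show False using assms by (auto simp: extreme_point_of_def)
qed

text \<open>Column sums of a sign matrix are end points of the interval from 0 to 1 that confines
  them, so the two ends of a segment through it have the same column sums. These already determine
  all entries.\<close>

lemma real_matrix_extreme:
  assumes M: "M \<in> sign_matrices v lam n"
  shows "(real_matrix M :: ('c, 'r) matrix) extreme_point_of solutions"
  unfolding extreme_point_of_def
proof (intro conjI ballI notI)
  let ?X = "real_matrix M :: ('c, 'r) matrix"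
  show "?X \<in> solutions" by (rule real_matrix_solution[OF M])
  fix a b assume a: "a \<in> solutions" and b: "b \<in> solutions" and seg: "?X \<in> open_segment a b"
  then obtain u where ab: "a \<noteq> b" and u: "0 < u" "u < 1" "?X = (1 - u) *\<^sub>R a + u *\<^sub>R b"
    by (auto simp: in_segment)
  have "flow a (Vert i j) = flow b (Vert i j)" if ij: "i \<in> {1..m}" "j \<in> {1..n}" for i j
  proof -
    let ?s = "flow a (Vert i j)" and ?t = "flow b (Vert i j)"
    have "flow ?X (Vert i j) = (1 - u) * ?s + u * ?t"
      unfolding u(3) by (simp only: linear_add[OF linear_flow] linear_scale[OF linear_flow] real_scaleR_def)
    moreover have "flow ?X (Vert i j) \<in> {0, 1}"
      unfolding flow_real_matrix[OF M] using M ij by (auto simp: sign_matrices_def sign_matrix_def)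
    ultimately have "(1 - u) * ?s + u * ?t \<in> {0, 1}" by simp
    moreover have bd: "0 \<le> ?s" "?s \<le> 1" "0 \<le> ?t" "?t \<le> 1"
      using solutions_Vert[OF a ij] solutions_Vert[OF b ij] by auto
    moreover have "0 \<le> (1 - u) * ?s" "0 \<le> u * ?t" "0 \<le> (1 - u) * (1 - ?s)" "0 \<le> u * (1 - ?t)"
      using bd u by auto
    moreover have "(1 - u) * (1 - ?s) + u * (1 - ?t) = 1 - ((1 - u) * ?s + u * ?t)"
      by (simp add: algebra_simps del: flow.simps)
    ultimately have "(1 - u) * ?s = 0 \<and> u * ?t = 0 \<or> (1 - u) * (1 - ?s) = 0 \<and> u * (1 - ?t) = 0"
      by (smt (verit) insert_iff singletonD)
    then show ?thesis using u by (auto simp del: flow.simps)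
  qed
  then have V: "flow a (Vert i j) = flow b (Vert i j)" if "i \<le> m" "j \<in> {1..n}" for i j
    using that by (cases "i = 0") auto
  have "a = b"
  proof (rule entry_inject)
    fix i j
    show "entry a i j = entry b i j"
    proof (cases "i \<in> {1..m} \<and> j \<in> {1..n}")
      case True
      then obtain i' where "i = Suc i'" by (cases i) auto
      then show ?thesis using True V[of i j] V[of i' j] by (simp only: entry_Suc) auto
    qed (use rows cols entry_outside in metis)
  qed
  then show False using ab by simp
qed

lemma extreme_points: "{x. x extreme_point_of solutions} = real_matrix ` sign_matrices v lam n"
proof (intro equalityI subsetI)
  fix x assume "x \<in> {x. x extreme_point_of solutions}"
  then have ext: "x extreme_point_of solutions" by simp
  have "entry x i j \<in> \<int>" for i j
  proof (cases i; cases j)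
    fix i' j' assume ij: "i = Suc i'" "j = Suc j'"
    have "entry x i j = (corner x (Suc i') (Suc j') - corner x (Suc i') j') - (corner x i' (Suc j') - corner x i' j')"
      unfolding ij by (simp only: entry_Suc flow_Vert_Suc)
    then show ?thesis using extreme_imp_integral[OF ext] by simp
  qed (auto simp: entry_outside)
  then show "x \<in> real_matrix ` sign_matrices v lam n"
    using integral_solution ext by (auto simp: extreme_point_of_def)
qed (use real_matrix_extreme in auto)

text \<open>Inner row sums have no explicit upper bound, but an entry is a difference of two column
  sums between 0 and 1.\<close>

lemma bounded_solutions: "bounded solutions"
proof -
  have "\<bar>entry X i j\<bar> \<le> 1" if X: "X \<in> solutions" for X i j
  proof (cases "i \<in> {1..m} \<and> j \<in> {1..n}")
    case True
    then obtain i' where i': "i = Suc i'" by (cases i) auto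
    have b: "0 \<le> flow X (Vert k j)" "flow X (Vert k j) \<le> 1" if "k \<le> m" for k
      using solutions_Vert[OF X, of k j] True that by (cases "k = 0"; simp)+
    show ?thesis using b[of i] b[of i'] True i' unfolding i' entry_Suc by (auto simp del: flow.simps)
  next
    case False
    then have "entry X i j = 0" using rows cols by (metis entry_outside)
    then show ?thesis by simp
  qed
  then have le: "\<bar>X $ r $ c\<bar> \<le> 1" if "X \<in> solutions" for X r c
    using that by (metis entry_position)
  have "norm X \<le> (\<Sum>r\<in>(UNIV::'r set). \<Sum>c\<in>(UNIV::'c set). 1)" if "X \<in> solutions" for X
  proof -
    have "norm X \<le> (\<Sum>r\<in>UNIV. norm (X $ r))" unfolding norm_vec_def by (intro L2_set_le_sum) auto
    also have "\<dots> \<le> (\<Sum>r\<in>UNIV. \<Sum>c\<in>UNIV. \<bar>X $ r $ c\<bar>)" by (intro sum_mono norm_le_l1_cart)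
    also have "\<dots> \<le> (\<Sum>r\<in>(UNIV::'r set). \<Sum>c\<in>(UNIV::'c set). 1)" using le that by (intro sum_mono) auto
    finally show ?thesis .
  qed
  then show ?thesis unfolding bounded_iff by blast
qed

text \<open>A compact convex set is the hull of its extreme points, and these are the generators of
  \<open>P\<close>.\<close>

lemma P_eq_solutions: "P = solutions"
proof -
  have "compact solutions" using bounded_solutions closed_solutions by (simp add: compact_eq_bounded_closed)
  then have "solutions = convex hull {x. x extreme_point_of solutions}"
    by (intro Krein_Milman_Minkowski convex_solutions)
  then show ?thesis unfolding extreme_points P_def sm_polytope_def by simp
qed

end

section \<open>Bounded faces of a grid drawing\<close>

text \<open>Cell \<open>(i, j)\<close> is the unit square whose upper left corner is the grid vertex \<open>(i, j)\<close>. Truncation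
  merges the half-planes above and to the left of the grid into the cells of row and column 0.\<close>

definition cell_of :: "real \<times> real \<Rightarrow> nat \<times> nat" where
  "cell_of p = (nat \<lfloor>- snd p\<rfloor>, nat \<lfloor>fst p\<rfloor>)"

definition center :: "nat \<times> nat \<Rightarrow> real \<times> real" where
  "center c = (real (snd c) + 1 / 2, - (real (fst c) + 1 / 2))"

text \<open>A step crosses the common side of two neighboring cells. All pairs of naturals are
  cells, including those outside the grid.\<close>

definition cell_step :: "edge set \<Rightarrow> ((nat \<times> nat) \<times> (nat \<times> nat)) set" where
  "cell_step D = {((i, j), (i, Suc j)) | i j. Vert i (Suc j) \<notin> D} \<union>
                 {((i, j), (Suc i, j)) | i j. Horiz (Suc i) j \<notin> D}"

definition cell_equiv :: "edge set \<Rightarrow> ((nat \<times> nat) \<times> (nat \<times> nat)) set" where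
  "cell_equiv D = (cell_step D \<union> (cell_step D)\<inverse>)\<^sup>*"

lemma equiv_cell_equiv: "equiv UNIV (cell_equiv D)"
  unfolding cell_equiv_def
  by (intro equivI sym_rtrancl sym_Un_converse trans_rtrancl refl_rtrancl) simp

lemma cell_equiv_refl [simp]: "(c, c) \<in> cell_equiv D"
  by (simp add: cell_equiv_def)

lemma cell_equiv_commute: "(c, d) \<in> cell_equiv D \<longleftrightarrow> (d, c) \<in> cell_equiv D"
  by (meson equivE equiv_cell_equiv symD)

lemma cell_equiv_trans: "(c, d) \<in> cell_equiv D \<Longrightarrow> (d, e) \<in> cell_equiv D \<Longrightarrow> (c, e) \<in> cell_equiv D"
  unfolding cell_equiv_def by (rule rtrancl_trans)

lemma cell_equiv_class_eq: "cell_equiv D `` {c} = cell_equiv D `` {d} \<longleftrightarrow> (c, d) \<in> cell_equiv D"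
  by (rule eq_equiv_class_iff[OF equiv_cell_equiv]) auto

lemma cell_equiv_Vert: "Vert i (Suc j) \<notin> D \<Longrightarrow> ((i, j), (i, Suc j)) \<in> cell_equiv D"
  unfolding cell_equiv_def cell_step_def by blast

lemma cell_equiv_Horiz: "Horiz (Suc i) j \<notin> D \<Longrightarrow> ((i, j), (Suc i, j)) \<in> cell_equiv D"
  unfolding cell_equiv_def cell_step_def by blast

lemma cell_equiv_invariant:
  assumes "(c, d) \<in> cell_equiv D" and "\<And>c d. (c, d) \<in> cell_step D \<Longrightarrow> h c = h d"
  shows "h c = h d"
  using assms(1) unfolding cell_equiv_def
  by (induction rule: rtrancl_induct) (use assms(2) in auto)

section \<open>Connected components of the complement of a drawing and classes of cells\<close>

lemma mem_edge_Vert: "p \<in> edge_segment (Vert i j) \<longleftrightarrow> fst p = j \<and> i \<le> - snd p \<and> - snd p \<le> i + 1"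
  by (cases p) (auto simp: vertex_point_def closed_segment_same_fst closed_segment_eq_real_ivl)

lemma mem_edge_Horiz: "p \<in> edge_segment (Horiz i j) \<longleftrightarrow> - snd p = i \<and> j \<le> fst p \<and> fst p \<le> j + 1"
  by (cases p) (auto simp: vertex_point_def closed_segment_same_snd closed_segment_eq_real_ivl)

lemma cell_of_center [simp]: "cell_of (center c) = c"
proof -
  have "\<lfloor>real k + 1 / 2\<rfloor> = int k" for k by linarith
  then show ?thesis by (simp add: cell_of_def center_def)
qed

text \<open>This makes the truncation in \<open>cell_of\<close> harmless: no edge meets the region
  where the first coordinate or the depth is below 1, so merging cells there loses nothing.\<close>

definition positive_edges :: "edge set \<Rightarrow> bool" where
  "positive_edges D \<longleftrightarrow> (\<forall>i j. Vert i j \<in> D \<or> Horiz i j \<in> D \<longrightarrow> 1 \<le> i \<and> 1 \<le> j)"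

definition free_plane :: "edge set \<Rightarrow> (real \<times> real) set" where
  "free_plane D = - (\<Union>e\<in>D. edge_segment e)"

lemma mem_free_plane: "p \<in> free_plane D \<longleftrightarrow>
    (\<forall>i j. Vert i j \<in> D \<longrightarrow> \<not> (fst p = j \<and> i \<le> - snd p \<and> - snd p \<le> i + 1)) \<and>
    (\<forall>i j. Horiz i j \<in> D \<longrightarrow> \<not> (- snd p = i \<and> j \<le> fst p \<and> fst p \<le> j + 1))"
proof -
  have "p \<in> free_plane D \<longleftrightarrow> (\<forall>e\<in>D. p \<notin> edge_segment e)" by (simp add: free_plane_def)
  also have "\<dots> \<longleftrightarrow> (\<forall>i j. Vert i j \<in> D \<longrightarrow> p \<notin> edge_segment (Vert i j)) \<and>
      (\<forall>i j. Horiz i j \<in> D \<longrightarrow> p \<notin> edge_segment (Horiz i j))"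
    by (metis edge.exhaust)
  finally show ?thesis unfolding mem_edge_Vert mem_edge_Horiz .
qed

lemma connected_component_segment:
  fixes p q :: "'a::real_normed_vector"
  shows "closed_segment p q \<subseteq> S \<Longrightarrow> connected_component S p q"
  unfolding connected_component_def
  by (intro exI[of _ "closed_segment p q"]) (auto intro: connected_segment)

lemma half_not_nat: "real k + 1 / 2 \<noteq> real l"
proof
  assume "real k + 1 / 2 = real l"
  then have "real (2 * k + 1) = real (2 * l)" by simp
  then have "2 * k + 1 = 2 * l" by (simp only: of_nat_eq_iff)
  then show False by presburger
qed

text \<open>The segment between the two centers meets the grid lines only in the midpoint of the
  common side, which is not drawn.\<close>

lemma cell_step_connected:
  assumes "(c, d) \<in> cell_step D"
  shows "connected_component (free_plane D) (center c) (center d)"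
proof (rule connected_component_segment, rule subsetI)
  fix p assume p: "p \<in> closed_segment (center c) (center d)"
  obtain x y where xy: "p = (x, y)" by (cases p)
  from assms consider
    (vert) i j where "c = (i, j)" "d = (i, Suc j)" "Vert i (Suc j) \<notin> D" |
    (horiz) i j where "c = (i, j)" "d = (Suc i, j)" "Horiz (Suc i) j \<notin> D"
    by (auto simp: cell_step_def)
  then show "p \<in> free_plane D"
  proof cases
    case vert
    then have y: "- y = real i + 1 / 2" and x: "real j < x" "x < real j + 2"
      using p xy by (auto simp: center_def closed_segment_same_snd closed_segment_eq_real_ivl)
    have 1: False if "Vert a b \<in> D" "x = real b" "real a \<le> - y" "- y \<le> real a + 1" for a b
    proof -
      have "a = i" "b = Suc j" using that x y by linarith+
      then show False using that(1) vert by simp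
    qed
    have 2: False if "- y = real a" for a
      using that y half_not_nat[of i a] by simp
    show ?thesis unfolding mem_free_plane xy using 1 2 by (auto simp: add.commute)
  next
    case horiz
    then have x: "x = real j + 1 / 2" and y: "real i < - y" "- y < real i + 2"
      using p xy by (auto simp: center_def closed_segment_same_fst closed_segment_eq_real_ivl)
    have 1: False if "Horiz a b \<in> D" "- y = real a" "real b \<le> x" "x \<le> real b + 1" for a b
    proof -
      have "a = Suc i" "b = j" using that x y by linarith+
      then show False using that(1) horiz by simp
    qed
    have 2: False if "x = real a" for a
      using that x half_not_nat[of j a] by simp
    show ?thesis unfolding mem_free_plane xy using 1 2 by (auto simp: add.commute)
  qed
qed

lemma center_free_plane: "center c \<in> free_plane D"
  using half_not_nat by (auto simp: mem_free_plane center_def add.commute)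

lemma cell_equiv_connected:
  assumes "(c, d) \<in> cell_equiv D"
  shows "connected_component (free_plane D) (center c) (center d)"
  using assms unfolding cell_equiv_def
proof (induction rule: rtrancl_induct)
  case base
  then show ?case using center_free_plane by simp
next
  case (step d e)
  then have "connected_component (free_plane D) (center d) (center e)"
    using cell_step_connected connected_component_sym by (metis UnE converseD)
  then show ?case using step.IH connected_component_trans by metis
qed

text \<open>On the straight way to the center both coordinates avoid all positive integers
  immediately after the start, while every edge lies on a line with a positive integer
  coordinate.\<close>

lemma connected_to_center:
  assumes D: "positive_edges D" and p: "p \<in> free_plane D"
  shows "connected_component (free_plane D) p (center (cell_of p))"
proof (rule connected_component_segment, rule subsetI)
  fix q assume q: "q \<in> closed_segment p (center (cell_of p))"
  \<comment> \<open>The argument for one coordinate. The lower bound is conditional because a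
    truncated coordinate with \<open>k = 0\<close> may be negative.\<close>
  have strict: "(1 - t) * x + t * (real k + 1 / 2) < real k + 1 \<and>
      (1 \<le> (1 - t) * x + t * (real k + 1 / 2) \<longrightarrow> real k < (1 - t) * x + t * (real k + 1 / 2))"
    if "k = nat \<lfloor>x\<rfloor>" "0 < t" "t \<le> 1" for x t :: real and k
  proof -
    have eq: "(1 - t) * x + t * (real k + 1 / 2) = real k + (1 - t) * (x - real k) + t / 2"
      by (simp add: algebra_simps)
    have x1: "x - real k < 1" using that(1) by linarith
    have "(1 - t) * (x - real k) \<le> (1 - t) * 1" using x1 that by (intro mult_left_mono) auto
    moreover have "k = 0 \<or> 0 \<le> (1 - t) * (x - real k)"
    proof (cases "k = 0")
      case False
      then have "0 \<le> x - real k" using that(1) by linarith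
      then show ?thesis using that by simp
    qed simp
    ultimately show ?thesis unfolding eq using that(2) by auto
  qed
  obtain t where t: "0 \<le> t" "t \<le> 1" "q = (1 - t) *\<^sub>R p + t *\<^sub>R center (cell_of p)"
    using q by (auto simp: in_segment)
  show "q \<in> free_plane D"
  \<comment> \<open>The starting point may itself lie on a grid line; it is free by
    assumption.\<close>
  proof (cases "t = 0")
    case True
    then show ?thesis using t p by simp
  next
    case False
    have fst: "fst q = (1 - t) * fst p + t * (real (nat \<lfloor>fst p\<rfloor>) + 1 / 2)"
      and snd: "- snd q = (1 - t) * (- snd p) + t * (real (nat \<lfloor>- snd p\<rfloor>) + 1 / 2)"
      unfolding t(3) center_def cell_of_def by (simp_all add: algebra_simps)
    have x: "fst q \<noteq> real b" if "1 \<le> b" for b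
    proof -
      have "fst q < real (nat \<lfloor>fst p\<rfloor>) + 1 \<and> (1 \<le> fst q \<longrightarrow> real (nat \<lfloor>fst p\<rfloor>) < fst q)"
        unfolding fst by (rule strict) (use t False in auto)
      then show ?thesis using that by auto
    qed
    have y: "- snd q \<noteq> real b" if "1 \<le> b" for b
    proof -
      have "- snd q < real (nat \<lfloor>- snd p\<rfloor>) + 1 \<and> (1 \<le> - snd q \<longrightarrow> real (nat \<lfloor>- snd p\<rfloor>) < - snd q)"
        unfolding snd by (rule strict) (use t False in auto)
      then show ?thesis using that by auto
    qed
    show ?thesis
      unfolding mem_free_plane using D x y by (auto simp: positive_edges_def)
  qed
qed

text \<open>Close to \<open>y\<close> the truncated floor can change only by dropping by one, and
  only if \<open>y\<close> is a positive integer, that is, if \<open>y\<close> is on a grid line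
  that may carry edges.\<close>

lemma nat_floor_near:
  fixes y :: real
  obtains \<epsilon> where "0 < \<epsilon>" "\<And>z. \<bar>z - y\<bar> < \<epsilon> \<Longrightarrow> nat \<lfloor>z\<rfloor> = nat \<lfloor>y\<rfloor> \<or> y = real (Suc (nat \<lfloor>z\<rfloor>))"
proof (cases "y \<in> \<int>")
  case True
  then obtain k where y: "y = of_int k" by (auto elim: Ints_cases)
  show ?thesis
  proof (rule that[of 1])
    fix z assume "\<bar>z - y\<bar> < 1"
    then have "of_int (k - 1) \<le> z" "z < of_int (k + 1)" unfolding y by auto
    then have "k - 1 \<le> \<lfloor>z\<rfloor>" "\<lfloor>z\<rfloor> < k + 1" by (simp_all only: le_floor_iff floor_less_iff)
    \<comment> \<open>In the middle case both floors truncate to 0.\<close>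
    then consider "\<lfloor>z\<rfloor> = k" | "\<lfloor>z\<rfloor> = k - 1" "k < 1" | "k = int (Suc (nat \<lfloor>z\<rfloor>))" by linarith
    then show "nat \<lfloor>z\<rfloor> = nat \<lfloor>y\<rfloor> \<or> y = real (Suc (nat \<lfloor>z\<rfloor>))"
    proof cases
      case 2
      then show ?thesis by (simp only: y floor_of_int) simp
    next
      case 3
      then show ?thesis by (simp only: y of_int_of_nat_eq) simp
    qed (simp add: y)
  qed simp
next
  case False
  then have "of_int \<lfloor>y\<rfloor> \<noteq> y" by (metis Ints_of_int)
  then have lt: "of_int \<lfloor>y\<rfloor> < y" by (simp add: less_le)
  show ?thesis
  proof (rule that[of "min (y - of_int \<lfloor>y\<rfloor>) (of_int \<lfloor>y\<rfloor> + 1 - y)"])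
    show "0 < min (y - of_int \<lfloor>y\<rfloor>) (of_int \<lfloor>y\<rfloor> + 1 - y)"
      using lt floor_correct[of y] by simp
    fix z assume "\<bar>z - y\<bar> < min (y - of_int \<lfloor>y\<rfloor>) (of_int \<lfloor>y\<rfloor> + 1 - y)"
    then have "of_int \<lfloor>y\<rfloor> \<le> z" "z < of_int \<lfloor>y\<rfloor> + 1" by (auto simp: abs_less_iff)
    then have "\<lfloor>z\<rfloor> = \<lfloor>y\<rfloor>" by (rule floor_unique)
    then show "nat \<lfloor>z\<rfloor> = nat \<lfloor>y\<rfloor> \<or> y = real (Suc (nat \<lfloor>z\<rfloor>))" by simp
  qed
qed

text \<open>If a nearby point is in another cell, then \<open>p\<close> lies on the side or at the
  corner between the two cells. The sides to be crossed contain \<open>p\<close> or are excluded by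
  \<open>positive_edges\<close>, so they are not drawn.\<close>

lemma cell_of_locally_equiv:
  assumes D: "positive_edges D" and p: "p \<in> free_plane D"
  obtains \<epsilon> where "0 < \<epsilon>" "\<And>q. dist p q < \<epsilon> \<Longrightarrow> (cell_of q, cell_of p) \<in> cell_equiv D"
proof -
  define u where "u = - snd p"
  define x where "x = fst p"
  obtain e1 where e1: "0 < e1"
    "\<And>z. \<bar>z - x\<bar> < e1 \<Longrightarrow> nat \<lfloor>z\<rfloor> = nat \<lfloor>x\<rfloor> \<or> (x = real (Suc (nat \<lfloor>z\<rfloor>)))"
    using nat_floor_near[of x] by metis
  obtain e2 where e2: "0 < e2"
    "\<And>z. \<bar>z - u\<bar> < e2 \<Longrightarrow> nat \<lfloor>z\<rfloor> = nat \<lfloor>u\<rfloor> \<or> (u = real (Suc (nat \<lfloor>z\<rfloor>)))"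
    using nat_floor_near[of u] by metis
  have V: "Vert i j \<notin> D" if "x = real j" "real i \<le> u" "u \<le> real i + 1" for i j
    using p that by (auto simp: mem_free_plane x_def u_def)
  have H: "Horiz i j \<notin> D" if "u = real i" "real j \<le> x" "x \<le> real j + 1" for i j
    using p that by (auto simp: mem_free_plane x_def u_def)
  have V0: "Vert 0 j \<notin> D" and H0: "Horiz i 0 \<notin> D" for i j
    using D by (auto simp: positive_edges_def)
  \<comment> \<open>At a grid vertex four cells meet. The way to the cell of \<open>p\<close> first
    corrects the column, in either of two rows, and then the row.\<close>
  have step_x: "((i, j), (i, nat \<lfloor>x\<rfloor>)) \<in> cell_equiv D"
    if "j = nat \<lfloor>x\<rfloor> \<or> x = real (Suc j)" "i = nat \<lfloor>u\<rfloor> \<or> u = real (Suc i)" for i j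
  proof (cases "j = nat \<lfloor>x\<rfloor>")
    case False
    then have x: "x = real (Suc j)" and fl: "nat \<lfloor>x\<rfloor> = Suc j" using that by auto
    have "Vert i (Suc j) \<notin> D"
    proof (cases "i = 0 \<or> u = real (Suc i)")
      case True
      then show ?thesis using V0 V[OF x, of i] by auto
    next
      case False
      then have "i = nat \<lfloor>u\<rfloor>" "i \<noteq> 0" using that by auto
      then have "real i \<le> u" "u \<le> real i + 1" by linarith+
      then show ?thesis using V[OF x] by blast
    qed
    then show ?thesis unfolding fl by (rule cell_equiv_Vert)
  qed simp
  have step_u: "((i, nat \<lfloor>x\<rfloor>), (nat \<lfloor>u\<rfloor>, nat \<lfloor>x\<rfloor>)) \<in> cell_equiv D"
    if "i = nat \<lfloor>u\<rfloor> \<or> u = real (Suc i)" for i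
  proof (cases "i = nat \<lfloor>u\<rfloor>")
    case False
    then have u: "u = real (Suc i)" and fl: "nat \<lfloor>u\<rfloor> = Suc i" using that by auto
    have "Horiz (Suc i) (nat \<lfloor>x\<rfloor>) \<notin> D"
    proof (cases "nat \<lfloor>x\<rfloor> = 0")
      case True
      then show ?thesis using H0 by simp
    next
      case False
      then have "real (nat \<lfloor>x\<rfloor>) \<le> x" "x \<le> real (nat \<lfloor>x\<rfloor>) + 1" by linarith+
      then show ?thesis using H[OF u] by blast
    qed
    then show ?thesis unfolding fl by (rule cell_equiv_Horiz)
  qed simp
  show ?thesis
  proof (rule that)
    show "0 < min e1 e2" using e1 e2 by simp
    fix q assume q: "dist p q < min e1 e2"
    have "\<bar>fst q - x\<bar> \<le> dist p q" "\<bar>- snd q - u\<bar> \<le> dist p q"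
      using dist_fst_le[of p q] dist_snd_le[of p q]
      by (auto simp: x_def u_def dist_real_def)
    then have "nat \<lfloor>fst q\<rfloor> = nat \<lfloor>x\<rfloor> \<or> x = real (Suc (nat \<lfloor>fst q\<rfloor>))"
      and "nat \<lfloor>- snd q\<rfloor> = nat \<lfloor>u\<rfloor> \<or> u = real (Suc (nat \<lfloor>- snd q\<rfloor>))"
      using e1(2)[of "fst q"] e2(2)[of "- snd q"] q by auto
    then show "(cell_of q, cell_of p) \<in> cell_equiv D"
      unfolding cell_of_def u_def[symmetric] x_def[symmetric]
      by (intro cell_equiv_trans[OF step_x step_u])
  qed
qed

text \<open>The class of the cell that contains a point is locally constant on the complement, hence
  constant on connected subsets.\<close>

lemma connected_imp_cell_equiv:
  assumes D: "positive_edges D" and conn: "connected_component (free_plane D) p q"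
  shows "(cell_of p, cell_of q) \<in> cell_equiv D"
proof -
  obtain S where S: "connected S" "S \<subseteq> free_plane D" "p \<in> S" "q \<in> S"
    using conn by (auto simp: connected_component_def)
  define f where "f r = cell_equiv D `` {cell_of r}" for r
  have "\<exists>T. openin (top_of_set S) T \<and> r \<in> T \<and> (\<forall>s\<in>T. f s = f r)" if r: "r \<in> S" for r
  proof -
    have "r \<in> free_plane D" using r S by auto
    then obtain \<epsilon> where "0 < \<epsilon>" "\<And>s. dist r s < \<epsilon> \<Longrightarrow> (cell_of s, cell_of r) \<in> cell_equiv D"
      using cell_of_locally_equiv[OF D] by metis
    then show ?thesis
      using r unfolding f_def cell_equiv_class_eq
      by (intro exI[of _ "S \<inter> ball r \<epsilon>"]) (auto simp: openin_open_Int)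
  qed
  then have "f constant_on S" using S(1) by (intro locally_constant_imp_constant) auto
  then have "f p = f q" using S by (auto simp: constant_on_def)
  then show ?thesis by (simp add: f_def cell_equiv_class_eq)
qed

lemma components_free_plane:
  assumes "positive_edges D"
  shows "components (free_plane D) = range (\<lambda>c. connected_component_set (free_plane D) (center c))"
proof (intro equalityI subsetI)
  fix C assume "C \<in> components (free_plane D)"
  then obtain p where p: "p \<in> free_plane D" "C = connected_component_set (free_plane D) p"
    by (auto simp: components_def)
  have "connected_component_set (free_plane D) (center (cell_of p)) = C"
    unfolding p(2) using connected_to_center[OF assms p(1)] by (intro connected_component_eq) simp
  then show "C \<in> range (\<lambda>c. connected_component_set (free_plane D) (center c))" by blast
qed (use center_free_plane in \<open>auto simp: components_def\<close>)

lemma component_center_eq: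
  assumes "positive_edges D"
  shows "connected_component_set (free_plane D) (center c) = connected_component_set (free_plane D) (center d)
     \<longleftrightarrow> (c, d) \<in> cell_equiv D"
proof -
  have "connected_component (free_plane D) (center c) (center d) \<longleftrightarrow> (c, d) \<in> cell_equiv D"
    using cell_equiv_connected connected_imp_cell_equiv[OF assms, of "center c" "center d"]
    unfolding cell_of_center by blast
  then show ?thesis
    using connected_component_eq_eq[of "free_plane D" "center c" "center d"] center_free_plane by simp
qed

section \<open>The boundary arc, the outer class of cells and the bounded components\<close>

definition arc_edges :: "nat \<Rightarrow> nat \<Rightarrow> edge set" where
  "arc_edges m n = Horiz (m + 1) ` {1..n} \<union> (\<lambda>i. Vert i (n + 1)) ` {1..m}"

lemma unit_intervals:
  "1 \<le> (x :: real) \<and> x \<le> real n + 1 \<longleftrightarrow> (\<exists>j\<in>{1..n}. real j \<le> x \<and> x \<le> real j + 1)" if "1 \<le> n"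
proof
  assume x: "1 \<le> x \<and> x \<le> real n + 1"
  \<comment> \<open>The minimum matters at the right end \<open>x = n + 1\<close>, which belongs to
    the last interval.\<close>
  let ?j = "min (nat \<lfloor>x\<rfloor>) n"
  have "1 \<le> ?j" "real ?j \<le> x" "x \<le> real ?j + 1" using x that by linarith+
  then show "\<exists>j\<in>{1..n}. real j \<le> x \<and> x \<le> real j + 1" by (intro bexI[of _ ?j]) auto
qed auto

lemma boundary_arc_eq:
  assumes "1 \<le> m" "1 \<le> n"
  shows "boundary_arc m n = (\<Union>e\<in>arc_edges m n. edge_segment e)"
proof (rule set_eqI)
  fix p :: "real \<times> real"
  have "p \<in> boundary_arc m n \<longleftrightarrow> (- snd p = real m + 1 \<and> 1 \<le> fst p \<and> fst p \<le> real n + 1) \<or>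
      (fst p = real n + 1 \<and> 1 \<le> - snd p \<and> - snd p \<le> real m + 1)"
    by (cases p) (auto simp: boundary_arc_def vertex_point_def closed_segment_same_fst
        closed_segment_same_snd closed_segment_eq_real_ivl)
  also have "\<dots> \<longleftrightarrow> p \<in> (\<Union>e\<in>arc_edges m n. edge_segment e)"
    unfolding arc_edges_def unit_intervals[OF assms(1)] unit_intervals[OF assms(2)]
    by (auto simp: mem_edge_Vert mem_edge_Horiz simp del: edge_segment.simps)
  finally show "p \<in> boundary_arc m n \<longleftrightarrow> p \<in> (\<Union>e\<in>arc_edges m n. edge_segment e)" .
qed

text \<open>The edges without fixed label, the only ones that can be dark.\<close>

definition inner_edges :: "nat \<Rightarrow> nat \<Rightarrow> edge set" where
  "inner_edges m n = {Vert i j | i j. i \<in> {1..<m} \<and> j \<in> {1..n}} \<union>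
                     {Horiz i j | i j. i \<in> {1..m} \<and> j \<in> {1..<n}}"

text \<open>The arc is open at its lower left and upper right ends. Inside it, row \<open>m\<close>
  leads left and column \<open>n\<close> leads up, since last edges are missing from
  \<open>D\<close>; cells beyond the arc go around it in the same way.\<close>

lemma outer_cells_equiv:
  assumes D: "D \<subseteq> inner_edges m n" and ij: "i = 0 \<or> j = 0 \<or> m \<le> i \<or> n \<le> j"
  shows "((i, j), (0, 0)) \<in> cell_equiv (D \<union> arc_edges m n)"
proof -
  let ?E = "cell_equiv (D \<union> arc_edges m n)"
  have row: "((i, j), (i, 0)) \<in> ?E" if "\<And>j'. j' < j \<Longrightarrow> Vert i (Suc j') \<notin> D \<union> arc_edges m n" for i j
    using that
  proof (induction j)
    case (Suc j)
    then have "((i, j), (i, Suc j)) \<in> ?E" by (intro cell_equiv_Vert) auto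
    then show ?case using Suc cell_equiv_trans cell_equiv_commute by (metis less_Suc_eq)
  qed simp
  have col: "((i, j), (0, j)) \<in> ?E" if "\<And>i'. i' < i \<Longrightarrow> Horiz (Suc i') j \<notin> D \<union> arc_edges m n" for i j
    using that
  proof (induction i)
    case (Suc i)
    then have "((i, j), (Suc i, j)) \<in> ?E" by (intro cell_equiv_Horiz) auto
    then show ?case using Suc cell_equiv_trans cell_equiv_commute by (metis less_Suc_eq)
  qed simp
  have row0: "((0, j), (0, 0)) \<in> ?E" for j
    using D by (intro row) (auto simp: inner_edges_def arc_edges_def)
  have col0: "((i, 0), (0, 0)) \<in> ?E" for i
    using D by (intro col) (auto simp: inner_edges_def arc_edges_def)
  \<comment> \<open>The extra conditions choose a way that does not cross the arc: from row
    \<open>m\<close> beyond column \<open>n\<close> one must go up, from column \<open>n\<close>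
    below row \<open>m\<close> one must go left.\<close>
  consider "i = 0 \<or> j = 0" | "m < i \<or> i = m \<and> j \<le> n" | "n < j \<or> j = n \<and> i \<le> m"
    using ij by linarith
  then show ?thesis
  proof cases
    case 1
    then show ?thesis using row0 col0 by auto
  next
    case 2
    then have "((i, j), (i, 0)) \<in> ?E"
      using D by (intro row) (auto simp: inner_edges_def arc_edges_def)
    then show ?thesis using col0 cell_equiv_trans by blast
  next
    case 3
    then have "((i, j), (0, j)) \<in> ?E"
      using D by (intro col) (auto simp: inner_edges_def arc_edges_def)
    then show ?thesis using row0 cell_equiv_trans by blast
  qed
qed

definition bounded_classes :: "nat \<Rightarrow> nat \<Rightarrow> edge set \<Rightarrow> (nat \<times> nat) set set" where
  "bounded_classes m n D =
     (\<lambda>c. cell_equiv (D \<union> arc_edges m n) `` {c}) ` {c. (c, (0, 0)) \<notin> cell_equiv (D \<union> arc_edges m n)}"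

text \<open>Used to count components by the classes of their cells: both are images of the same set
  of cells, under maps with the same fibres.\<close>

lemma card_image_eq:
  assumes "\<And>x y. x \<in> A \<Longrightarrow> y \<in> A \<Longrightarrow> f x = f y \<longleftrightarrow> g x = g y"
  shows "card (f ` A) = card (g ` A)"
proof -
  have "bij_betw (\<lambda>z. g (inv_into A f z)) (f ` A) (g ` A)"
  proof (rule bij_betw_imageI)
    have inv: "inv_into A f (f x) \<in> A" "f (inv_into A f (f x)) = f x" if "x \<in> A" for x
      using that by (auto intro: inv_into_into f_inv_into_f)
    have g: "g (inv_into A f (f x)) = g x" if "x \<in> A" for x
      using assms inv[OF that] that by blast
    show "inj_on (\<lambda>z. g (inv_into A f z)) (f ` A)"
      using assms by (auto simp: inj_on_def g)
    show "(\<lambda>z. g (inv_into A f z)) ` f ` A = g ` A"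
      by (simp add: image_image g cong: image_cong)
  qed
  then show ?thesis by (rule bij_betw_same_card)
qed

text \<open>A component whose class is not the outer one stays in a box, since outer cells surround
  the grid. The outer component contains a half-plane.\<close>

lemma card_bounded_components:
  assumes m: "1 \<le> m" and n: "1 \<le> n" and D: "D \<subseteq> inner_edges m n"
  shows "card {C \<in> components (- ((\<Union>e\<in>D. edge_segment e) \<union> boundary_arc m n)). bounded C} =
    card (bounded_classes m n D)"
proof -
  let ?D = "D \<union> arc_edges m n"
  let ?comp = "\<lambda>c. connected_component_set (free_plane ?D) (center c)"
  let ?A = "{c. (c, (0, 0)) \<notin> cell_equiv ?D}"
  have plane: "- ((\<Union>e\<in>D. edge_segment e) \<union> boundary_arc m n) = free_plane ?D"
    unfolding boundary_arc_eq[OF m n] free_plane_def by (simp add: Un_ac)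
  have pos: "positive_edges ?D"
    using D by (auto simp: positive_edges_def inner_edges_def arc_edges_def)
  have "bounded (?comp c) \<longleftrightarrow> c \<in> ?A" for c
  proof
    assume "c \<in> ?A"
    have "?comp c \<subseteq> {0..real n + 1} \<times> {- (real m + 1)..0}"
    proof
      fix p assume "p \<in> ?comp c"
      then have "(c, cell_of p) \<in> cell_equiv ?D"
        using connected_imp_cell_equiv[OF pos, of "center c" p] by simp
      then have "(cell_of p, (0, 0)) \<notin> cell_equiv ?D"
        using \<open>c \<in> ?A\<close> cell_equiv_trans by blast
      then have "0 < nat \<lfloor>- snd p\<rfloor>" "0 < nat \<lfloor>fst p\<rfloor>" "nat \<lfloor>- snd p\<rfloor> < m" "nat \<lfloor>fst p\<rfloor> < n"
        using outer_cells_equiv[OF D, of "fst (cell_of p)" "snd (cell_of p)"]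
        by (auto simp: cell_of_def not_le[symmetric])
      then have "0 \<le> fst p" "fst p \<le> real n + 1" "0 \<le> - snd p" "- snd p \<le> real m + 1"
        by linarith+
      then show "p \<in> {0..real n + 1} \<times> {- (real m + 1)..0}" by (cases p) auto
    qed
    then show "bounded (?comp c)"
      by (rule bounded_subset[rotated]) (intro bounded_Times bounded_closed_interval)
  next
    assume bd: "bounded (?comp c)"
    show "c \<in> ?A"
    proof (rule ccontr)
      assume "c \<notin> ?A"
      then have eq: "?comp c = ?comp (0, 0)" using component_center_eq[OF pos] by simp
      \<comment> \<open>The open half-plane to the left of all edges; it contains the center of cell
        \<open>(0, 0)\<close>.\<close>
      let ?H = "{..<1} \<times> UNIV :: (real \<times> real) set"
      have "?H \<subseteq> free_plane ?D"
      proof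
        fix p assume "p \<in> ?H"
        then have "\<not> real b \<le> fst p" if "1 \<le> b" for b using that by auto
        then show "p \<in> free_plane ?D"
          using pos by (fastforce simp: mem_free_plane positive_edges_def)
      qed
      moreover have "connected ?H" by (intro convex_connected convex_Times) auto
      moreover have "center (0, 0) \<in> ?H" by (simp add: center_def)
      ultimately have "?H \<subseteq> ?comp (0, 0)" by (intro connected_component_maximal)
      then have "bounded ?H" using bd eq bounded_subset by metis
      then have "bounded (snd ` ?H)" by (rule bounded_snd)
      then show False by simp
    qed
  qed
  then have "{C \<in> components (free_plane ?D). bounded C} = ?comp ` ?A"
    unfolding components_free_plane[OF pos] by auto
  then show ?thesis
    unfolding plane bounded_classes_def
    by (simp add: component_center_eq[OF pos] cell_equiv_class_eq card_image_eq)
qed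

section \<open>Labelings and tight inequalities\<close>

text \<open>The dictionary between label sets and tightness: the bound chosen by \<open>s\<close> is
  attained throughout exactly if the opposite value is missing.\<close>

lemma all_eq_bit_iff:
  assumes "C \<subseteq> {0, 1 :: int}"
  shows "(\<forall>x\<in>C. x = (if s then 1 else 0)) \<longleftrightarrow> (if s then 0 else 1) \<notin> C"
proof (cases s)
  case True
  have "(\<forall>x\<in>C. x = 1) \<longleftrightarrow> 0 \<notin> C" using assms by auto
  then show ?thesis using True by simp
next
  case False
  have "(\<forall>x\<in>C. x = 0) \<longleftrightarrow> 1 \<notin> C" using assms by auto
  then show ?thesis using False by simp
qed

text \<open>A closed form free of \<open>label_union\<close>. Nonemptiness of \<open>S\<close> is
  essential: the empty union is undefined on the grid as well.\<close>

lemma labeling_union_eq: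
  assumes "S \<noteq> {}"
  shows "labeling_union (zero_dim_component v lam n ` S) e =
    (if e \<notin> grid_edges (hd lam) n then None
     else Some (case e of
       Vert i j \<Rightarrow>
         if i < hd lam then Vals ((\<lambda>M. col_psum M i j) ` S)
         else Fixed (if j \<in> set v then 1 else 0)
     | Horiz i j \<Rightarrow>
         if j < n then (if \<exists>M\<in>S. row_psum M i j \<noteq> 0 then Star else Zero)
         else Fixed (count_list lam (hd lam - i + 1))))"
proof -
  define g where "g M = the (zero_dim_component v lam n M e)" for M
  have label_union_const: "label_union {Fixed c} = Fixed c" for c
    by (auto simp: label_union_def)
  show ?thesis
  proof (cases "e \<in> grid_edges (hd lam) n")
    case False
    then have "{l. \<exists>\<delta>\<in>zero_dim_component v lam n ` S. \<delta> e = Some l} = {}"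
      by (auto simp: zero_dim_component_def)
    then show ?thesis using False by (simp add: labeling_union_def)
  next
    case True
    have "{l. \<exists>\<delta>\<in>zero_dim_component v lam n ` S. \<delta> e = Some l} = g ` S"
      using True by (auto simp: g_def zero_dim_component_def)
    then have eq: "labeling_union (zero_dim_component v lam n ` S) e = Some (label_union (g ` S))"
      using assms by (simp add: labeling_union_def)
    show ?thesis
    proof (cases e)
      case (Vert i j)
      show ?thesis
      proof (cases "i < hd lam")
        case i: True
        then have "g = (\<lambda>M. Vals {col_psum M i j})" using Vert True by (auto simp: g_def zero_dim_component_def)
        moreover have "(\<Union>{A. Vals A \<in> (\<lambda>M. Vals {col_psum M i j}) ` S}) = (\<lambda>M. col_psum M i j) ` S"
          by auto
        ultimately have "label_union (g ` S) = Vals ((\<lambda>M. col_psum M i j) ` S)"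
          by (auto simp: label_union_def)
        then show ?thesis using eq True Vert i by simp
      next
        case i: False
        then have "g ` S = {Fixed (if j \<in> set v then 1 else 0)}"
          using Vert True assms by (auto simp: g_def zero_dim_component_def)
        then show ?thesis using eq True Vert i by (simp add: label_union_const)
      qed
    next
      case (Horiz i j)
      show ?thesis
      proof (cases "j < n")
        case j: True
        then have g: "g = (\<lambda>M. if row_psum M i j = 0 then Zero else Star)"
          using Horiz True by (auto simp: g_def zero_dim_component_def)
        have "label_union (g ` S) = (if \<exists>M\<in>S. row_psum M i j \<noteq> 0 then Star else Zero)"
          using assms unfolding g by (auto simp: label_union_def image_iff)
        then show ?thesis using eq True Horiz j by simp
      next
        case j: False
        then have "g ` S = {Fixed (count_list lam (hd lam - i + 1))}"
          using Horiz True assms by (auto simp: g_def zero_dim_component_def)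
        then show ?thesis using eq True Horiz j by (simp add: label_union_const)
      qed
    qed
  qed
qed

context matrix_setting
begin

abbreviation matrices where "matrices \<equiv> sign_matrices v lam n"

abbreviation component :: "(nat \<Rightarrow> nat \<Rightarrow> int) set \<Rightarrow> labeling" where
  "component S \<equiv> labeling_union (zero_dim_component v lam n ` S)"

definition vertices :: "('c, 'r) matrix set \<Rightarrow> (nat \<Rightarrow> nat \<Rightarrow> int) set" where
  "vertices F = {M \<in> matrices. real_matrix M \<in> F}"

definition tight_matrices :: "(nat \<Rightarrow> nat \<Rightarrow> int) set \<Rightarrow> (edge \<times> bool) set" where
  "tight_matrices S = tight (real_matrix ` S)"

lemma tight_matrices_antimono: "S \<subseteq> S' \<Longrightarrow> tight_matrices S' \<subseteq> tight_matrices S"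
  unfolding tight_matrices_def by (intro tight_antimono image_mono)

lemma col_psum_01: "M \<in> matrices \<Longrightarrow> i \<in> {1..m} \<Longrightarrow> j \<in> {1..n} \<Longrightarrow> col_psum M i j \<in> {0, 1}"
  by (auto simp: sign_matrices_def sign_matrix_def)

lemma functional_fixed:
  assumes "x \<in> solutions" "(e, s) \<in> constraints" "\<not> is_inner m n e"
  shows "functional (e, s) x = rhs (e, s)"
proof (cases e)
  case (Vert i j)
  then have "i \<in> {1..m}" "j \<in> {1..n}" "i = m"
    using assms by (auto simp: constraints_def grid_Vert)
  then show ?thesis using solutions_Vert(3)[OF assms(1)] Vert
    by (simp add: functional_def rhs_def lower_def upper_def del: flow.simps)
next
  case (Horiz i j)
  then have "i \<in> {1..m}" "j \<in> {1..n}" "j = n"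
    using assms by (auto simp: constraints_def grid_Horiz)
  then show ?thesis using solutions_Horiz(2)[OF assms(1)] Horiz
    by (simp add: functional_def rhs_def lower_def upper_def del: flow.simps)
qed

text \<open>Last edges are tight for both flags. An inner horizontal edge has only the flag for its
  lower bound, which fits the two labels \<open>Zero\<close> and \<open>Star\<close>.\<close>

lemma mem_tight_matrices:
  assumes S: "S \<subseteq> matrices"
  shows "(Vert i j, s) \<in> tight_matrices S \<longleftrightarrow> i \<in> {1..m} \<and> j \<in> {1..n} \<and>
      (i < m \<longrightarrow> (\<forall>M\<in>S. col_psum M i j = (if s then 1 else 0)))"
    and "(Horiz i j, s) \<in> tight_matrices S \<longleftrightarrow> i \<in> {1..m} \<and> j \<in> {1..n} \<and>
      (j < n \<longrightarrow> \<not> s \<and> (\<forall>M\<in>S. row_psum M i j = 0))"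
proof -
  have sol: "real_matrix M \<in> solutions" if "M \<in> S" for M
    using that S real_matrix_solution by auto
  have mem: "(e, s) \<in> tight_matrices S \<longleftrightarrow>
      (e, s) \<in> constraints \<and> (is_inner m n e \<longrightarrow> (\<forall>M\<in>S. functional (e, s) (real_matrix M) = rhs (e, s)))" for e
    using functional_fixed[OF sol] by (auto simp: tight_matrices_def tight_def)
  have flow: "functional (Vert i j, s) (real_matrix M) = (if s then - col_psum M i j else col_psum M i j)"
    "functional (Horiz i j, s) (real_matrix M) = (if s then - row_psum M i j else row_psum M i j)"
    if "M \<in> S" for M
    using flow_real_matrix[of M] that S by (auto simp: functional_def simp del: flow.simps)
  have one: "- real_of_int k = - 1 \<longleftrightarrow> k = 1" for k by linarith
  show "(Vert i j, s) \<in> tight_matrices S \<longleftrightarrow> i \<in> {1..m} \<and> j \<in> {1..n} \<and>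
      (i < m \<longrightarrow> (\<forall>M\<in>S. col_psum M i j = (if s then 1 else 0)))"
    unfolding mem by (auto simp: flow constraints_def grid_Vert rhs_def lower_def upper_def one)
  show "(Horiz i j, s) \<in> tight_matrices S \<longleftrightarrow> i \<in> {1..m} \<and> j \<in> {1..n} \<and>
      (j < n \<longrightarrow> \<not> s \<and> (\<forall>M\<in>S. row_psum M i j = 0))"
    unfolding mem by (auto simp: flow constraints_def grid_Horiz rhs_def lower_def upper_def)
qed

text \<open>Enlarging a label means losing tight bounds. For subsets of {0, 1}, inclusion says that
  a value missing from the larger set is missing from the smaller one, so a bound tight on the
  larger is tight on the smaller.\<close>

lemma component_le_iff:
  assumes S: "S \<subseteq> matrices" "S \<noteq> {}" and S': "S' \<subseteq> matrices" "S' \<noteq> {}"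
  shows "labeling_le (component S) (component S') \<longleftrightarrow> tight_matrices S' \<subseteq> tight_matrices S"
proof -
  \<comment> \<open>Fixed labels agree in all components, so only conditions on inner edges
    remain.\<close>
  have "labeling_le (component S) (component S') \<longleftrightarrow>
      (\<forall>i\<in>{1..m}. \<forall>j\<in>{1..n}.
        (i < m \<longrightarrow> (\<lambda>M. col_psum M i j) ` S \<subseteq> (\<lambda>M. col_psum M i j) ` S') \<and>
        (j < n \<longrightarrow> (\<forall>M\<in>S'. row_psum M i j = 0) \<longrightarrow> (\<forall>M\<in>S. row_psum M i j = 0)))"
    (is "_ \<longleftrightarrow> ?R")
  proof -
    have "labeling_le (component S) (component S') \<longleftrightarrow>
      (\<forall>e\<in>grid_edges m n. label_le (the (component S e)) (the (component S' e)))"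
      unfolding labeling_le_def labeling_union_eq[OF S(2)] labeling_union_eq[OF S'(2)] by auto
    also have "\<dots> \<longleftrightarrow> (\<forall>i\<in>{1..m}. \<forall>j\<in>{1..n}.
        label_le (the (component S (Vert i j))) (the (component S' (Vert i j))) \<and>
        label_le (the (component S (Horiz i j))) (the (component S' (Horiz i j))))"
      unfolding grid_edges_def by auto
    also have "\<dots> \<longleftrightarrow> ?R"
      unfolding labeling_union_eq[OF S(2)] labeling_union_eq[OF S'(2)]
      by (intro ball_cong refl) (auto simp: grid_Vert grid_Horiz)
    finally show ?thesis .
  qed
  also have "\<dots> \<longleftrightarrow> (\<forall>i\<in>{1..m}. \<forall>j\<in>{1..n}. \<forall>s.
        ((Vert i j, s) \<in> tight_matrices S' \<longrightarrow> (Vert i j, s) \<in> tight_matrices S) \<and>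
        ((Horiz i j, s) \<in> tight_matrices S' \<longrightarrow> (Horiz i j, s) \<in> tight_matrices S))"
  proof (intro ball_cong refl)
    fix i j assume ij: "i \<in> {1..m}" "j \<in> {1..n}"
    have *: "A \<subseteq> B \<longleftrightarrow> (\<forall>s. (\<forall>x\<in>B. x = (if s then 1 else 0)) \<longrightarrow> (\<forall>x\<in>A. x = (if s then 1 else 0)))"
      if "A \<subseteq> {0, 1}" "B \<subseteq> {0, 1}" for A B :: "int set"
    proof -
      have "A \<subseteq> B \<longleftrightarrow> (1 \<notin> B \<longrightarrow> 1 \<notin> A) \<and> (0 \<notin> B \<longrightarrow> 0 \<notin> A)" using that by blast
      then show ?thesis unfolding all_eq_bit_iff[OF that(1)] all_eq_bit_iff[OF that(2)] all_bool_eq by auto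
    qed
    have sub: "(\<lambda>M. col_psum M i j) ` S \<subseteq> {0, 1}" "(\<lambda>M. col_psum M i j) ` S' \<subseteq> {0, 1}"
      using S(1) S'(1) col_psum_01 ij by blast+
    show "(i < m \<longrightarrow> (\<lambda>M. col_psum M i j) ` S \<subseteq> (\<lambda>M. col_psum M i j) ` S') \<and>
        (j < n \<longrightarrow> (\<forall>M\<in>S'. row_psum M i j = 0) \<longrightarrow> (\<forall>M\<in>S. row_psum M i j = 0)) \<longleftrightarrow>
      (\<forall>s. ((Vert i j, s) \<in> tight_matrices S' \<longrightarrow> (Vert i j, s) \<in> tight_matrices S) \<and>
        ((Horiz i j, s) \<in> tight_matrices S' \<longrightarrow> (Horiz i j, s) \<in> tight_matrices S))"
      unfolding mem_tight_matrices[OF S(1)] mem_tight_matrices[OF S'(1)] *[OF sub]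
      using ij by (auto simp: all_bool_eq)
  qed
  also have "\<dots> \<longleftrightarrow> tight_matrices S' \<subseteq> tight_matrices S" (is "?L \<longleftrightarrow> _")
  proof
    assume L: ?L
    show "tight_matrices S' \<subseteq> tight_matrices S"
    proof
      fix k assume k: "k \<in> tight_matrices S'"
      obtain e s where es: "k = (e, s)" by (cases k)
      have "k \<in> constraints" using k tight_subset unfolding tight_matrices_def by blast
      then have "e \<in> grid_edges m n" by (simp add: constraints_def es)
      then show "k \<in> tight_matrices S"
        using L k es by (cases e) (simp_all add: grid_Vert grid_Horiz)
    qed
  qed (meson subsetD)
  finally show ?thesis .
qed

section \<open>Faces, their vertices and the order isomorphism\<close>

lemma extreme_point_of_face_iff:
  assumes "F face_of P" "M \<in> matrices"
  shows "real_matrix M extreme_point_of F \<longleftrightarrow> real_matrix M \<in> F"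
  using extreme_point_of_face[OF assms(1)] real_matrix_extreme[OF assms(2)] P_eq_solutions by simp

lemma psi_eq: "F face_of P \<Longrightarrow> psi v lam n F = component (vertices F)"
  unfolding psi_def vertices_def
  by (rule arg_cong[of _ _ "\<lambda>S. labeling_union (zero_dim_component v lam n ` S)"])
    (auto simp: extreme_point_of_face_iff)

lemma face_eq_hull_vertices:
  assumes F: "F face_of P"
  shows "F = convex hull (real_matrix ` vertices F)"
proof -
  have "compact P"
    using bounded_solutions closed_solutions P_eq_solutions by (simp add: compact_eq_bounded_closed)
  then have "compact F" using F convex_solutions P_eq_solutions face_of_imp_compact by blast
  then have "F = convex hull {x. x extreme_point_of F}"
    using face_of_imp_convex[OF F] by (rule Krein_Milman_Minkowski)
  moreover have "{x. x extreme_point_of F} = {x. x extreme_point_of solutions} \<inter> F"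
    using extreme_point_of_face[OF F] P_eq_solutions by auto
  moreover have "\<dots> = real_matrix ` vertices F"
    unfolding extreme_points vertices_def by auto
  ultimately show ?thesis by simp
qed

lemma tight_vertices:
  assumes "F face_of P"
  shows "tight_matrices (vertices F) = tight F"
  using face_eq_hull_vertices[OF assms] tight_hull[of "real_matrix ` vertices F"]
  by (simp add: tight_matrices_def)

lemma vertices_empty_iff:
  assumes "F face_of P"
  shows "vertices F = {} \<longleftrightarrow> F = {}"
proof
  assume "vertices F = {}"
  then show "F = {}" using face_eq_hull_vertices[OF assms] by simp
qed (simp add: vertices_def)

lemma vertices_subset: "vertices F \<subseteq> matrices"
  by (auto simp: vertices_def)

lemma component_empty: "component {} = Map.empty"
  by (simp add: labeling_union_def fun_eq_iff)

lemma component_nonempty: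
  assumes "S \<noteq> {}"
  shows "\<exists>e l. component S e = Some l"
proof -
  have "Vert 1 1 \<in> grid_edges m n" using m_pos n_pos by (simp add: grid_Vert)
  then show ?thesis using labeling_union_eq[OF assms, of v lam n "Vert 1 1"] by auto
qed

text \<open>For nonempty faces both sides say that the tight sets are included in reverse. The empty
  face is separate because its labeling is undefined everywhere.\<close>

lemma psi_le_iff:
  assumes F: "F face_of P" and G: "G face_of P"
  shows "labeling_le (psi v lam n F) (psi v lam n G) \<longleftrightarrow> F \<subseteq> G"
proof (cases "F = {}")
  case True
  then have "vertices F = {}" using vertices_empty_iff[OF F] by simp
  then show ?thesis unfolding psi_eq[OF F] using True component_empty by (simp add: labeling_le_def)
next
  case False
  then have vF: "vertices F \<noteq> {}" using vertices_empty_iff[OF F] by simp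
  show ?thesis
  proof (cases "G = {}")
    case True
    then have "vertices G = {}" using vertices_empty_iff[OF G] by simp
    then have "\<not> labeling_le (psi v lam n F) (psi v lam n G)"
      unfolding psi_eq[OF F] psi_eq[OF G]
      using component_empty component_nonempty[OF vF] by (auto simp: labeling_le_def)
    then show ?thesis using True False by simp
  next
    case nonempty: False
    then have vG: "vertices G \<noteq> {}" using vertices_empty_iff[OF G] by simp
    have "F face_of solutions" "G face_of solutions" using F G P_eq_solutions by auto
    then have "F \<subseteq> G \<longleftrightarrow> tight G \<subseteq> tight F" using face_subset_iff False nonempty by blast
    then show ?thesis
      unfolding psi_eq[OF F] psi_eq[OF G] component_le_iff[OF vertices_subset vF vertices_subset vG]
        tight_vertices[OF F] tight_vertices[OF G] by simp
  qed
qed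

lemma labeling_le_antisym:
  assumes "labeling_le \<delta> \<epsilon>" "labeling_le \<epsilon> \<delta>"
  shows "\<delta> = \<epsilon>"
proof
  have label: "l = l'" if "label_le l l'" "label_le l' l" for l l'
    using that by (cases l; cases l') auto
  show "\<delta> e = \<epsilon> e" for e
    using assms label by (cases "\<delta> e"; cases "\<epsilon> e") (fastforce simp: labeling_le_def)+
qed

text \<open>The face wanted is the smallest one that contains the given matrices. It may have
  further vertices, but these satisfy every equation that is tight on \<open>S\<close>, so adding
  them leaves the union of labelings unchanged.\<close>

lemma psi_surj:
  assumes "\<delta> \<in> grid_components v lam n"
  shows "\<exists>F. F face_of P \<and> psi v lam n F = \<delta>"
proof (cases "\<delta> = Map.empty")
  case True
  have "vertices {} = {}" by (simp add: vertices_def)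
  then have "psi v lam n ({} :: ('c, 'r) matrix set) = \<delta>"
    using psi_eq[of "{}"] component_empty True by simp
  then show ?thesis by (intro exI[of _ "{}"]) simp
next
  case False
  then obtain D where "D \<noteq> {}" "D \<subseteq> zero_dim_component v lam n ` matrices" "\<delta> = labeling_union D"
    using assms by (auto simp: grid_components_def)
  then obtain S where "S \<subseteq> matrices" "D = zero_dim_component v lam n ` S"
    unfolding subset_image_iff by auto
  then have S: "S \<subseteq> matrices" "S \<noteq> {}" "\<delta> = component S"
    using \<open>D \<noteq> {}\<close> \<open>\<delta> = labeling_union D\<close> by auto
  let ?F = "tight_solutions (tight_matrices S)"
  have F: "?F face_of P"
    unfolding P_eq_solutions by (rule face_tight_solutions) (simp add: tight_matrices_def tight_subset)
  have S_sub: "S \<subseteq> vertices ?F"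
  proof
    fix M assume M: "M \<in> S"
    then have "real_matrix M \<in> ?F"
      using S(1) real_matrix_solution[of M] by (auto simp: tight_solutions_def tight_matrices_def tight_def)
    then show "M \<in> vertices ?F" using M S(1) by (auto simp: vertices_def)
  qed
  then have nonempty: "vertices ?F \<noteq> {}" using S(2) by auto
  have "tight_matrices S \<subseteq> tight_matrices (vertices ?F)"
  proof
    fix k assume k: "k \<in> tight_matrices S"
    then have "k \<in> constraints" using tight_subset unfolding tight_matrices_def by blast
    moreover have "\<forall>x\<in>real_matrix ` vertices ?F. functional k x = rhs k"
      using k by (auto simp: vertices_def tight_solutions_def)
    ultimately show "k \<in> tight_matrices (vertices ?F)"
      unfolding tight_matrices_def tight_def by blast
  qed
  moreover have "tight_matrices (vertices ?F) \<subseteq> tight_matrices S"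
    using S_sub by (rule tight_matrices_antimono)
  ultimately have "component (vertices ?F) = component S"
    using component_le_iff[OF vertices_subset nonempty S(1,2)]
      component_le_iff[OF S(1,2) vertices_subset nonempty]
    by (intro labeling_le_antisym) simp_all
  then show ?thesis using F psi_eq[OF F] S(3) by auto
qed

lemma psi_in_components:
  assumes "F face_of P"
  shows "psi v lam n F \<in> grid_components v lam n"
proof (cases "vertices F = {}")
  case True
  then show ?thesis using psi_eq[OF assms] component_empty by (simp add: grid_components_def)
next
  case False
  then have "zero_dim_component v lam n ` vertices F \<noteq> {}"
    "zero_dim_component v lam n ` vertices F \<subseteq> zero_dim_component v lam n ` matrices"
    using vertices_subset by blast+
  then show ?thesis unfolding psi_eq[OF assms] grid_components_def by blast
qed

lemma bij_betw_psi: "bij_betw (psi v lam n) {F. F face_of P} (grid_components v lam n)"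
proof (rule bij_betw_imageI)
  show "inj_on (psi v lam n) {F. F face_of P}"
  proof (rule inj_onI)
    fix F G assume *: "F \<in> {F. F face_of P}" "G \<in> {F. F face_of P}" "psi v lam n F = psi v lam n G"
    then have F: "F face_of P" and G: "G face_of P" by auto
    show "F = G"
      using psi_le_iff[OF F F] psi_le_iff[OF F G] psi_le_iff[OF G F] *(3) by auto
  qed
  show "psi v lam n ` {F. F face_of P} = grid_components v lam n"
    using psi_surj psi_in_components by (auto simp: image_iff)
qed

section \<open>Dark edges and the direction space of a face\<close>

lemma mem_dark_edges:
  "Vert i j \<in> dark_edges \<delta> \<longleftrightarrow> \<delta> (Vert i j) = Some (Vals {0, 1})"
  "Horiz i j \<in> dark_edges \<delta> \<longleftrightarrow> \<delta> (Horiz i j) = Some Star"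
  by (auto simp: dark_edges_def)

lemma dark_Vert_component:
  assumes S: "S \<noteq> {}" "S \<subseteq> matrices"
  shows "Vert i j \<in> dark_edges (component S) \<longleftrightarrow>
    Vert i j \<in> grid_edges m n \<and> i < m \<and> (\<forall>s. (Vert i j, s) \<notin> tight_matrices S)"
proof (cases "Vert i j \<in> grid_edges m n \<and> i < m")
  case True
  then have ij: "i \<in> {1..m}" "j \<in> {1..n}" by (auto simp: grid_Vert)
  let ?A = "(\<lambda>M. col_psum M i j) ` S"
  have sub: "?A \<subseteq> {0, 1}" using col_psum_01[OF _ ij] S(2) by blast
  have "component S (Vert i j) = Some (Vals ?A)"
    using True by (simp add: labeling_union_eq[OF S(1)])
  then have "Vert i j \<in> dark_edges (component S) \<longleftrightarrow> ?A = {0, 1}"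
    by (simp add: mem_dark_edges)
  also have "\<dots> \<longleftrightarrow> 0 \<in> ?A \<and> 1 \<in> ?A" using sub by blast
  also have "\<dots> \<longleftrightarrow> (\<forall>s. (if s then 0 else 1) \<in> ?A)" unfolding all_bool_eq by auto
  also have "\<dots> \<longleftrightarrow> (\<forall>s. \<not> (\<forall>x\<in>?A. x = (if s then 1 else 0)))"
    unfolding all_eq_bit_iff[OF sub] by simp
  also have "\<dots> \<longleftrightarrow> (\<forall>s. (Vert i j, s) \<notin> tight_matrices S)"
    using True ij unfolding mem_tight_matrices[OF S(2)] by blast
  finally show ?thesis using True by blast
next
  case False
  then show ?thesis by (auto simp: mem_dark_edges labeling_union_eq[OF S(1)])
qed

lemma dark_Horiz_component:
  assumes S: "S \<noteq> {}" "S \<subseteq> matrices"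
  shows "Horiz i j \<in> dark_edges (component S) \<longleftrightarrow>
    Horiz i j \<in> grid_edges m n \<and> j < n \<and> (\<forall>s. (Horiz i j, s) \<notin> tight_matrices S)"
proof (cases "Horiz i j \<in> grid_edges m n \<and> j < n")
  case True
  then have ij: "i \<in> {1..m}" "j \<in> {1..n}" by (auto simp: grid_Horiz)
  have "component S (Horiz i j) = Some (if \<exists>M\<in>S. row_psum M i j \<noteq> 0 then Star else Zero)"
    using True by (simp add: labeling_union_eq[OF S(1)])
  then have "Horiz i j \<in> dark_edges (component S) \<longleftrightarrow> (\<exists>M\<in>S. row_psum M i j \<noteq> 0)"
    by (simp add: mem_dark_edges)
  also have "\<dots> \<longleftrightarrow> (\<forall>s. (Horiz i j, s) \<notin> tight_matrices S)"
    using True ij unfolding mem_tight_matrices[OF S(2)] by blast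
  finally show ?thesis using True by blast
next
  case False
  then show ?thesis by (auto simp: mem_dark_edges labeling_union_eq[OF S(1)])
qed

lemma dark_edges_psi:
  assumes F: "F face_of P" "F \<noteq> {}"
  shows "e \<in> dark_edges (psi v lam n F) \<longleftrightarrow> e \<in> grid_edges m n \<and> is_inner m n e \<and> (\<forall>s. (e, s) \<notin> tight F)"
proof -
  have "vertices F \<noteq> {}" using vertices_empty_iff[OF F(1)] F(2) by simp
  from dark_Vert_component[OF this vertices_subset] dark_Horiz_component[OF this vertices_subset]
  show ?thesis
    unfolding psi_eq[OF F(1)] tight_vertices[OF F(1), symmetric] by (cases e) simp_all
qed

lemma dark_edges_inner:
  assumes "F face_of P" "F \<noteq> {}"
  shows "dark_edges (psi v lam n F) \<subseteq> inner_edges m n"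
proof
  fix e assume "e \<in> dark_edges (psi v lam n F)"
  then have "e \<in> grid_edges m n" "is_inner m n e" using dark_edges_psi[OF assms] by auto
  then show "e \<in> inner_edges m n" by (cases e) (auto simp: grid_edges_def inner_edges_def)
qed

text \<open>An edge that is not dark is tight, or off the grid. In the latter case its flow is zero
  or repeats that of a last edge, where every constraint is tight; so the condition extends from the
  grid to all edges.\<close>

lemma tight_kernel:
  assumes F: "F face_of P" "F \<noteq> {}"
  shows "{w. \<forall>k\<in>tight F. functional k w = 0} =
    {w :: ('c, 'r) matrix. \<forall>e. e \<notin> dark_edges (psi v lam n F) \<longrightarrow> flow w e = 0}"
proof (intro equalityI subsetI)
  fix w :: "('c, 'r) matrix"
  assume "w \<in> {w. \<forall>k\<in>tight F. functional k w = 0}"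
  then have w: "flow w e = 0" if "(e, s) \<in> tight F" for e s
    using that by (force simp: functional_def split: if_splits)
  have grid: "flow w e = 0" if "e \<in> grid_edges m n" "e \<notin> dark_edges (psi v lam n F)" for e
  proof (cases "is_inner m n e")
    case True
    then show ?thesis using dark_edges_psi[OF F] that w by metis
  next
    case False
    have "(e, False) \<in> constraints" using that by (simp add: constraints_def)
    then have "(e, False) \<in> tight F"
      using functional_fixed[OF _ _ False] face_of_imp_subset[OF F(1)] P_eq_solutions
      by (auto simp: tight_def)
    then show ?thesis by (rule w)
  qed
  have last: "flow w (Vert m j) = 0" "flow w (Horiz i n) = 0" for i j
  proof -
    have "\<not> is_inner m n (Vert m j)" "\<not> is_inner m n (Horiz i n)" by simp_all
    then have dark: "Vert m j \<notin> dark_edges (psi v lam n F)" "Horiz i n \<notin> dark_edges (psi v lam n F)"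
      using dark_edges_psi[OF F] by blast+
    show "flow w (Vert m j) = 0"
    proof (cases "j \<in> {1..n}")
      case True
      then show ?thesis using grid[OF _ dark(1)] m_pos by (simp add: grid_Vert del: flow.simps)
    qed (use cols in \<open>simp add: entry_outside\<close>)
    show "flow w (Horiz i n) = 0"
    proof (cases "i \<in> {1..m}")
      case True
      then show ?thesis using grid[OF _ dark(2)] n_pos by (simp add: grid_Horiz del: flow.simps)
    qed (use rows in \<open>simp add: entry_outside\<close>)
  qed
  have "flow w e = 0" if "e \<notin> dark_edges (psi v lam n F)" for e
  proof (cases "e \<in> grid_edges m n")
    case False
    then show ?thesis using flow_outside[of e w] last rows cols
      by (cases e) (auto simp del: flow.simps)
  qed (use grid that in auto)
  then show "w \<in> {w. \<forall>e. e \<notin> dark_edges (psi v lam n F) \<longrightarrow> flow w e = 0}" by blast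
next
  fix w :: "('c, 'r) matrix"
  assume w: "w \<in> {w. \<forall>e. e \<notin> dark_edges (psi v lam n F) \<longrightarrow> flow w e = 0}"
  have "functional k w = 0" if "k \<in> tight F" for k
  proof -
    obtain e s where k: "k = (e, s)" by (cases k)
    then have "e \<notin> dark_edges (psi v lam n F)" using dark_edges_psi[OF F] that by blast
    then show ?thesis using w k by (simp add: functional_def)
  qed
  then show "w \<in> {w. \<forall>k\<in>tight F. functional k w = 0}" by blast
qed

end

section \<open>Dimension of faces\<close>

text \<open>The extra edges \<open>E\<close>, later those of the arc, only remove steps.\<close>

lemma corner_eq_cell_step:
  assumes "\<And>e. e \<notin> D \<Longrightarrow> flow w e = 0" and "(c, d) \<in> cell_step (D \<union> E)"
  shows "corner w (fst c) (snd c) = corner w (fst d) (snd d)"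
  using assms(2)
proof (auto simp: cell_step_def)
  fix i j
  show "corner w i j = corner w i (Suc j)" if "Vert i (Suc j) \<notin> D"
    using assms(1)[OF that] by (simp add: flow_Vert_Suc del: flow.simps)
  show "corner w i j = corner w (Suc i) j" if "Horiz (Suc i) j \<notin> D"
    using assms(1)[OF that] by (simp add: flow_Horiz_Suc del: flow.simps)
qed

lemma flow_0 [simp]: "flow X (Vert i 0) = 0" "flow X (Horiz 0 j) = 0"
  by (simp_all add: entry_outside)

definition class_matrix :: "(nat \<times> nat) set \<Rightarrow> real ^ 'c::{finite,linorder} ^ 'r::{finite,linorder}" where
  "class_matrix K = of_corner (\<lambda>i j. if (i, j) \<in> K then 1 else 0)"

text \<open>The corner sums identify the flows that are supported on \<open>D\<close> with the functions on cells that
  are constant on classes and vanish on the outer class; the indicator functions of the other classes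
  are a basis.\<close>

lemma dim_flows:
  fixes D :: "edge set"
  defines "W \<equiv> {w :: real ^ 'c::{finite,linorder} ^ 'r::{finite,linorder}. \<forall>e. e \<notin> D \<longrightarrow> flow w e = 0}"
  assumes D: "D \<subseteq> inner_edges CARD('r) CARD('c)"
  shows "dim W = card (bounded_classes CARD('r) CARD('c) D)"
proof -
  let ?E = "cell_equiv (D \<union> arc_edges CARD('r) CARD('c))"
  let ?K = "bounded_classes CARD('r) CARD('c) D"
  let ?B = "class_matrix :: (nat \<times> nat) set \<Rightarrow> real ^ 'c::{finite,linorder} ^ 'r::{finite,linorder}"
  \<comment> \<open>This is the vanishing condition under which \<open>of_corner\<close> realizes
    the indicator function of \<open>K\<close>.\<close>
  have outer: "(i, j) \<notin> K" if K: "K \<in> ?K" and ij: "i = 0 \<or> j = 0 \<or> CARD('r) \<le> i \<or> CARD('c) \<le> j" for K i j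
  proof
    assume "(i, j) \<in> K"
    then obtain c where "(c, (0, 0)) \<notin> ?E" "(c, (i, j)) \<in> ?E" using K by (auto simp: bounded_classes_def)
    then show False using outer_cells_equiv[OF D ij] cell_equiv_trans by blast
  qed
  have corner: "corner (?B K) i j = (if (i, j) \<in> K then 1 else 0)" if "K \<in> ?K" for K i j
    unfolding class_matrix_def using outer[OF that] by (intro corner_of_corner) auto
  have class_eq: "K = ?E `` {c}" if "K \<in> ?K" "c \<in> K" for K c
  proof -
    obtain d where d: "K = ?E `` {d}" using \<open>K \<in> ?K\<close> unfolding bounded_classes_def by blast
    then have "(d, c) \<in> ?E" using \<open>c \<in> K\<close> by simp
    then show ?thesis unfolding d cell_equiv_class_eq .
  qed
  have invariant: "c \<in> K \<longleftrightarrow> d \<in> K" if "K \<in> ?K" "(c, d) \<in> ?E" for K c d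
    using class_eq[OF that(1), of c] class_eq[OF that(1), of d] that(2) cell_equiv_commute[of c d] by blast
  have disjoint: "K = L" if "K \<in> ?K" "L \<in> ?K" "c \<in> K" "c \<in> L" for K L c
    using class_eq[OF that(1,3)] class_eq[OF that(2,4)] by (rule trans[OF _ sym])
  have rep: "\<exists>c. c \<in> K" if "K \<in> ?K" for K
  proof -
    obtain d where "K = ?E `` {d}" using \<open>K \<in> ?K\<close> unfolding bounded_classes_def by blast
    then show ?thesis by (intro exI[of _ d]) simp
  qed
  have finite: "finite ?K"
  proof -
    have "c \<in> {..CARD('r)} \<times> {..CARD('c)}" if "(c, (0, 0)) \<notin> ?E" for c
    proof -
      have "\<not> (CARD('r) \<le> fst c \<or> CARD('c) \<le> snd c)"
        using outer_cells_equiv[OF D, of "fst c" "snd c"] that by auto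
      then show ?thesis by (cases c) auto
    qed
    then have "{c. (c, (0, 0)) \<notin> ?E} \<subseteq> {..CARD('r)} \<times> {..CARD('c)}" by blast
    then have "finite {c. (c, (0, 0)) \<notin> ?E}" by (rule finite_subset) simp
    then show ?thesis unfolding bounded_classes_def by (rule finite_imageI)
  qed
  have inj: "inj_on ?B ?K"
  proof (rule inj_onI)
    fix K L assume KL: "K \<in> ?K" "L \<in> ?K" "?B K = ?B L"
    obtain i j where ij: "(i, j) \<in> K" using rep[OF KL(1)] by auto
    have "(i, j) \<in> L" using corner[OF KL(1), of i j] corner[OF KL(2), of i j] KL(3) ij by (simp split: if_splits)
    then show "K = L" using disjoint KL ij by blast
  qed
  have sub: "?B ` ?K \<subseteq> W"
  proof clarify
    fix K assume K: "K \<in> ?K"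
    have "flow (?B K) e = 0" if e: "e \<notin> D" for e
    \<comment> \<open>Arc edges block steps although a flow supported on \<open>D\<close> must
      vanish on them. It does, because the cells on both sides of the arc are outer.\<close>
    proof (cases "e \<in> arc_edges CARD('r) CARD('c)")
      case True
      then consider j where "e = Horiz (Suc CARD('r)) j" | i where "e = Vert i (Suc CARD('c))"
        by (auto simp: arc_edges_def)
      then show ?thesis
        by cases (simp_all add: flow_Horiz_Suc flow_Vert_Suc corner[OF K] outer[OF K] del: flow.simps)
    next
      case False
      then have free: "e \<notin> D \<union> arc_edges CARD('r) CARD('c)" using e by simp
      show ?thesis
      proof (cases e)
        case (Vert i j)
        show ?thesis
        proof (cases j)
          case (Suc j')
          then show ?thesis using invariant[OF K cell_equiv_Vert, of i j'] free Vert
            by (simp add: flow_Vert_Suc corner[OF K] del: flow.simps)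
        qed (simp add: Vert del: flow.simps)
      next
        case (Horiz i j)
        show ?thesis
        proof (cases i)
          case (Suc i')
          then show ?thesis using invariant[OF K cell_equiv_Horiz, of i' j] free Horiz
            by (simp add: flow_Horiz_Suc corner[OF K] del: flow.simps)
        qed (simp add: Horiz del: flow.simps)
      qed
    qed
    then show "?B K \<in> W" by (simp add: W_def)
  qed
  define r where "r K = (SOME c. c \<in> K)" for K :: "(nat \<times> nat) set"
  have r: "r K \<in> K" if "K \<in> ?K" for K
    unfolding r_def using rep[OF that] by (rule someI_ex)
  have corner_sum: "corner (\<Sum>K\<in>?K. a K *\<^sub>R ?B K) i j = (\<Sum>K\<in>?K. a K * (if (i, j) \<in> K then 1 else 0))"
    for a i j
    by (simp add: linear_sum[OF linear_corner] linear_scale[OF linear_corner] corner)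
  have single: "(\<Sum>K\<in>?K. a K * (if (i, j) \<in> K then 1 else 0)) = a L" if "L \<in> ?K" "(i, j) \<in> L"
    for a :: "(nat \<times> nat) set \<Rightarrow> real" and i j L
  proof -
    have "(\<Sum>K\<in>?K. a K * (if (i, j) \<in> K then 1 else 0)) = (\<Sum>K\<in>?K. if K = L then a K else 0)"
      using that disjoint by (intro sum.cong) auto
    then show ?thesis using finite that by simp
  qed
  have indep: "independent (?B ` ?K)"
  proof (rule independent_if_scalars_zero)
    fix f x assume sum: "(\<Sum>x\<in>?B ` ?K. f x *\<^sub>R x) = 0" and "x \<in> ?B ` ?K"
    then obtain L where L: "L \<in> ?K" "x = ?B L" by auto
    obtain i j where ij: "(i, j) \<in> L" using rep[OF L(1)] by auto
    have "(\<Sum>K\<in>?K. f (?B K) *\<^sub>R ?B K) = 0" using sum by (simp add: sum.reindex[OF inj])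
    then have "corner (\<Sum>K\<in>?K. f (?B K) *\<^sub>R ?B K) i j = 0"
      by (simp only: linear_0[OF linear_corner])
    then have "(\<Sum>K\<in>?K. f (?B K) * (if (i, j) \<in> K then 1 else 0)) = 0"
      by (simp only: corner_sum)
    then show "f x = 0" using single[OF L(1) ij, of "\<lambda>K. f (?B K)"] L by simp
  qed (use finite in simp)
  have span: "W \<subseteq> span (?B ` ?K)"
  proof
    fix w assume w: "w \<in> W"
    have const: "corner w (fst c) (snd c) = corner w (fst d) (snd d)" if "(c, d) \<in> ?E" for c d
      by (rule cell_equiv_invariant[OF that])
        (rule corner_eq_cell_step, use w in \<open>auto simp: W_def\<close>)
    let ?h = "\<lambda>c. corner w (fst c) (snd c)"
    \<comment> \<open>The coefficient at a class is the corner sum of \<open>w\<close> at any of its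
      cells. On the outer class the corner sum equals that at \<open>(0, 0)\<close>, which is
      0.\<close>
    have "w = (\<Sum>K\<in>?K. ?h (r K) *\<^sub>R ?B K)"
    proof (rule corner_inject)
      fix i j
      show "corner w i j = corner (\<Sum>K\<in>?K. ?h (r K) *\<^sub>R ?B K) i j"
      proof (cases "((i, j), (0, 0)) \<in> ?E")
        case True
        have "(i, j) \<notin> K" if "K \<in> ?K" for K
          using invariant[OF that True] outer[OF that, of 0 0] by simp
        then show ?thesis using const[OF True] by (simp add: corner_sum)
      next
        case False
        let ?L = "?E `` {(i, j)}"
        have L: "?L \<in> ?K" "(i, j) \<in> ?L" using False by (auto simp: bounded_classes_def)
        have "((i, j), r ?L) \<in> ?E" using r[OF L(1)] by simp
        then have "corner w i j = ?h (r ?L)" using const by fastforce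
        then show ?thesis unfolding corner_sum single[OF L] .
      qed
    qed
    moreover have "(\<Sum>K\<in>?K. ?h (r K) *\<^sub>R ?B K) \<in> span (?B ` ?K)"
      by (intro span_sum span_scale span_base) auto
    ultimately show "w \<in> span (?B ` ?K)" by simp
  qed
  show ?thesis
    using dim_unique[OF sub span indep refl] card_image[OF inj] by simp
qed

lemma (in matrix_setting) aff_dim_eq_regions:
  assumes F: "F face_of P"
  shows "aff_dim F = regions m n (psi v lam n F)"
proof (cases "F = {}")
  case True
  then have "psi v lam n F = Map.empty"
    using psi_eq[OF F] vertices_empty_iff[OF F] component_empty by simp
  then show ?thesis using True by (simp add: regions_def)
next
  case False
  let ?D = "dark_edges (psi v lam n F)"
  have "psi v lam n F \<noteq> Map.empty"
    using component_nonempty[of "vertices F"] psi_eq[OF F] vertices_empty_iff[OF F] False by auto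
  then have "regions m n (psi v lam n F) = card (bounded_classes m n ?D)"
    using card_bounded_components[OF _ _ dark_edges_inner[OF F False]] m_pos n_pos
    by (simp add: regions_def)
  moreover have "aff_dim F = dim {w. \<forall>k\<in>tight F. functional k w = 0}"
    using aff_dim_face F False P_eq_solutions by simp
  moreover have "dim {w. \<forall>k\<in>tight F. functional k w = 0} = card (bounded_classes m n ?D)"
    unfolding tight_kernel[OF F False]
    using dim_flows[of ?D, where 'c='c and 'r='r] dark_edges_inner[OF F False] rows cols by simp
  ultimately show ?thesis by simp
qed

theorem theorem9p10:
  fixes lam v :: "nat list" and n :: nat
    and P :: "(real ^ 'c::{finite,linorder} ^ 'r::{finite,linorder}) set"
  assumes "is_partition lam" and "lam \<noteq> []"
    and "0 < n"
    and "length v = length lam" and "sorted_wrt (<) v" and "set v \<subseteq> {1..n}"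
    and "CARD('r) = hd lam" and "CARD('c) = n"
    and "P = sm_polytope v lam n"
  shows "bij_betw (psi v lam n) {F. F face_of P} (grid_components v lam n) \<and>
         (\<forall>F G. F face_of P \<longrightarrow> G face_of P \<longrightarrow>
            (F \<subseteq> G \<longleftrightarrow> labeling_le (psi v lam n F) (psi v lam n G))) \<and>
         (\<forall>F. F face_of P \<longrightarrow> aff_dim F = regions (hd lam) n (psi v lam n F))"
proof -
  interpret matrix_setting v lam n P
    using assms by unfold_locales
  show ?thesis using bij_betw_psi psi_le_iff aff_dim_eq_regions by blast
qed

end
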